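(* Let $n\ge2$ and let $\Omega\subset\mathbb{R}^2$ be a simply connected domain. (a) If $f=(f_1,\dots,f_n):\Omega\to\mathbb{R}^n$ is a positive area-angle map with area-angle $\Theta:\Omega\to(0,\frac{\pi}{2}]$ whose graph $\mathbf{\Phi}$ is a minimal surface in $\mathbb{R}^{n+2}$, then there exists a positive area-angle map $g=(g_1,\dots,g_n):\Omega\to\mathbb{R}^n$ with the same area-angle $\Theta$ whose graph $\widehat{\mathbf{\Phi}}$ is a maximal surface in $\mathbb{R}^{n+2}_n$. (b) Conversely, if $g=(g_1,\dots,g_n):\Omega\to\mathbb{R}^n$ is a positive area-angle map with area-angle $\Theta:\Omega\to(0,\frac{\pi}{2}]$ whose graph $\widehat{\mathbf{\Phi}}$ is a maximal surface in $\mathbb{R}^{n+2}_n$, then there exists a positive area-angle map $f=(f_1,\dots,f_n):\Omega\to\mathbb{R}^n$ with the same area-angle $\Theta$ whose graph $\mathbf{\Phi}$ is a minimal surface in $\mathbb{R}^{n+2}$. (c) The correspondence $\mathbf{\Phi}\Leftrightarrow\widehat{\mathbf{\Phi}}$ in (a) and (b) (the twin correspondence) can be taken to satisfy the following relations, where $E\,dx^2+2F\,dx\,dy+G\,dy^2=ds^2_{\mathbf{\Phi}}$ and $\widehat{E}\,dx^2+2\widehat{F}\,dx\,dy+\widehat{G}\,dy^2=ds^2_{\widehat{\mathbf{\Phi}}}$ are the induced metrics, $\omega=\sqrt{EG-F^2}$ and $\widehat{\omega}=\sqrt{\widehat{E}\widehat{G}-\widehat{F}^2}$. (c1) (Twin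 relations) For all $k\in\{1,\dots,n\}$, $$\left(\frac{\partial g_k}{\partial x},\frac{\partial g_k}{\partial y}\right)=\left(-\frac{E}{\omega}\frac{\partial f_k}{\partial y}+\frac{F}{\omega}\frac{\partial f_k}{\partial x},\;\frac{G}{\omega}\frac{\partial f_k}{\partial x}-\frac{F}{\omega}\frac{\partial f_k}{\partial y}\right),$$ or equivalently, for all $k\in\{1,\dots,n\}$, $$\left(\frac{\partial f_k}{\partial x},\frac{\partial f_k}{\partial y}\right)=\left(\frac{\widehat{E}}{\widehat{\omega}}\frac{\partial g_k}{\partial y}-\frac{\widehat{F}}{\widehat{\omega}}\frac{\partial g_k}{\partial x},\;-\frac{\widehat{G}}{\widehat{\omega}}\frac{\partial g_k}{\partial x}+\frac{\widehat{F}}{\widehat{\omega}}\frac{\partial g_k}{\partial y}\right).$$ (c2) The two graphs share the area-angle; in fact each Jacobian determinant is preserved: $$\frac{\partial(f_i,f_j)}{\partial(x,y)}=\frac{\partial(g_i,g_j)}{\partial(x,y)},\qquad i,j\in\{1,\dots,n\}.$$ (c3) (Angle duality) $\widehat{\omega}\,\omega=\sin^2\Theta>0$. (c4) The two induced metrics are conformally equivalent; in fact $ds^2_{\mathbf{\Phi}}=\frac{\omega}{\widehat{\omega}}\,ds^2_{\widehat{\mathbf{\Phi}}}$. (d) The two integrability conditions in (c1) being equivalent, the twin correspondence is involutive: if $\Sigma$ is a minimal graph as in (a), $\widehat{\Sigma}$ is its twin maximal graph, and $\widehat{\widehat{\Sigma}}$ is the twin minimal graph of $\widehat{\Sigma}$,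 then $\widehat{\widehat{\Sigma}}$ is congruent to $\Sigma$ up to vertical translations.
   Context: All functions are of class at least $C^2$. $\mathbb{R}^{n+2}$ carries the Euclidean metric $dx_1^2+\cdots+dx_{n+2}^2$, and $\mathbb{R}^{n+2}_n$ is $\mathbb{R}^{n+2}$ with the pseudo-Euclidean metric $dx_1^2+dx_2^2-dx_3^2-\cdots-dx_{n+2}^2$. Area-angle: for $n\ge2$ and $\phi=(\phi_1,\dots,\phi_n):\Omega\to\mathbb{R}^n$ put $\mathcal{J}_{i,j}=\frac{\partial(\phi_i,\phi_j)}{\partial(x,y)}$ and $\|\mathcal{J}\|=\sqrt{\sum_{1\le i<j\le n}\mathcal{J}_{i,j}^2}$. If $\|\mathcal{J}\|<1$ on $\Omega$, $\phi$ is called a positive area-angle map, and its area-angle is the function $\Theta_\phi=\cos^{-1}(\|\mathcal{J}\|)$ on $\Omega$ with values in $(0,\frac{\pi}{2}]$. The graph of $f$ is $\mathbf{\Phi}(x,y)=(x,y,f_1(x,y),\dots,f_n(x,y))$ in $\mathbb{R}^{n+2}$, with $E=1+\sum_k(\partial_x f_k)^2$, $F=\sum_k\partial_x f_k\,\partial_y f_k$, $G=1+\sum_k(\partial_y f_k)^2$; it is a minimal surface if and only if $G\,\partial_{xx}f_k-2F\,\partial_{xy}f_k+E\,\partial_{yy}f_k=0$ for all $k$. The graph of $g$ is $\widehat{\mathbf{\Phi}}(x,y)=(x,y,g_1(x,y),\dots,g_n(x,y))$ in $\mathbb{R}^{n+2}_n$, with $\widehat{E}=1-\sum_k(\partial_x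 g_k)^2$, $\widehat{F}=-\sum_k\partial_x g_k\,\partial_y g_k$, $\widehat{G}=1-\sum_k(\partial_y g_k)^2$. It is spacelike if the induced metric is positive definite (so $\widehat{E}\widehat{G}-\widehat{F}^2>0$). A maximal surface in $\mathbb{R}^{n+2}_n$ is a spacelike surface of zero mean curvature; a spacelike graph is maximal if and only if $\widehat{G}\,\partial_{xx}g_k-2\widehat{F}\,\partial_{xy}g_k+\widehat{E}\,\partial_{yy}g_k=0$ for all $k$. The twin of a graph is the graph associated to it by (a) or (b) through the relations (c1); it is determined up to vertical translations, i.e. up to adding constants to the height functions. *)

theory Defs
  imports "HOL-Analysis.Analysis"
begin

section \<open>Calculus of maps on the plane\<close>

definition partial_x :: "(real \<times> real \<Rightarrow> 'a::real_normed_vector) \<Rightarrow> real \<times> real \<Rightarrow> 'a" where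
  "partial_x \<phi> p = vector_derivative (\<lambda>t. \<phi> (t, snd p)) (at (fst p))"

definition partial_y :: "(real \<times> real \<Rightarrow> 'a::real_normed_vector) \<Rightarrow> real \<times> real \<Rightarrow> 'a" where
  "partial_y \<phi> p = vector_derivative (\<lambda>t. \<phi> (fst p, t)) (at (snd p))"

text \<open>Class $C^2$ in the Frechet sense; intended for open \<open>S\<close>. The continuity of the first
  derivative is implied by its differentiability.\<close>

definition C2_on :: "'b::real_normed_vector set \<Rightarrow> ('b \<Rightarrow> 'a::real_normed_vector) \<Rightarrow> bool" where
  "C2_on S \<phi> \<longleftrightarrow>
    (\<exists>(D1 :: 'b \<Rightarrow> 'b \<Rightarrow>\<^sub>L 'a) (D2 :: 'b \<Rightarrow> 'b \<Rightarrow>\<^sub>L 'b \<Rightarrow>\<^sub>L 'a).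
       (\<forall>p\<in>S. (\<phi> has_derivative blinfun_apply (D1 p)) (at p)) \<and>
       (\<forall>p\<in>S. (D1 has_derivative blinfun_apply (D2 p)) (at p)) \<and>
       continuous_on S D2)"

section \<open>Area-angle\<close>

text \<open>Maps from the plane to $\mathbb{R}^n$. The spelling \<open>(real, 'n) vec\<close> of \<open>real ^ 'n\<close> adds no
  sort constraint to \<open>'n\<close>.\<close>

type_synonym 'n height_map = "real \<times> real \<Rightarrow> (real, 'n) vec"

definition jacobian_det ::
    "'n::finite height_map \<Rightarrow> 'n \<Rightarrow> 'n \<Rightarrow> real \<times> real \<Rightarrow> real" where
  "jacobian_det \<phi> i j p =
     partial_x (\<lambda>q. \<phi> q $ i) p * partial_y (\<lambda>q. \<phi> q $ j) p -
     partial_y (\<lambda>q. \<phi> q $ i) p * partial_x (\<lambda>q. \<phi> q $ j) p"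

text \<open>The linear order on the index type plays the role of the order on $\{1,\dots,n\}$; it only
  serves to count each pair of indices once.\<close>

definition jacobian_norm ::
    "'n::{finite,linorder} height_map \<Rightarrow> real \<times> real \<Rightarrow> real" where
  "jacobian_norm \<phi> p = sqrt (\<Sum>(i, j) \<in> {(i, j). i < j}. (jacobian_det \<phi> i j p)\<^sup>2)"

definition positive_area_angle_map ::
    "(real \<times> real) set \<Rightarrow> 'n::{finite,linorder} height_map \<Rightarrow> bool" where
  "positive_area_angle_map \<Omega> \<phi> \<longleftrightarrow> C2_on \<Omega> \<phi> \<and> (\<forall>p\<in>\<Omega>. jacobian_norm \<phi> p < 1)"

definition area_angle ::
    "'n::{finite,linorder} height_map \<Rightarrow> real \<times> real \<Rightarrow> real" where
  "area_angle \<phi> p = arccos (jacobian_norm \<phi> p)"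

section \<open>Parametrized surfaces in a vector space with a symmetric bilinear form\<close>

text \<open>Throughout, \<open>B\<close> is the ambient (pseudo-)Euclidean inner product and \<open>X\<close> a parametrized
  surface.\<close>

definition metric_E ::
    "('a \<Rightarrow> 'a \<Rightarrow> real) \<Rightarrow> (real \<times> real \<Rightarrow> 'a::real_normed_vector) \<Rightarrow> real \<times> real \<Rightarrow> real" where
  "metric_E B X p = B (partial_x X p) (partial_x X p)"

definition metric_F ::
    "('a \<Rightarrow> 'a \<Rightarrow> real) \<Rightarrow> (real \<times> real \<Rightarrow> 'a::real_normed_vector) \<Rightarrow> real \<times> real \<Rightarrow> real" where
  "metric_F B X p = B (partial_x X p) (partial_y X p)"

definition metric_G ::
    "('a \<Rightarrow> 'a \<Rightarrow> real) \<Rightarrow> (real \<times> real \<Rightarrow> 'a::real_normed_vector) \<Rightarrow> real \<times> real \<Rightarrow> real" where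
  "metric_G B X p = B (partial_y X p) (partial_y X p)"

text \<open>The quadratic form $ds^2 = E\,dx^2 + 2F\,dx\,dy + G\,dy^2$ evaluated at a tangent vector.\<close>

definition induced_metric ::
    "('a \<Rightarrow> 'a \<Rightarrow> real) \<Rightarrow> (real \<times> real \<Rightarrow> 'a::real_normed_vector) \<Rightarrow>
      real \<times> real \<Rightarrow> real \<times> real \<Rightarrow> real" where
  "induced_metric B X p v =
     metric_E B X p * (fst v)\<^sup>2 + 2 * metric_F B X p * fst v * snd v + metric_G B X p * (snd v)\<^sup>2"

definition area_element ::
    "('a \<Rightarrow> 'a \<Rightarrow> real) \<Rightarrow> (real \<times> real \<Rightarrow> 'a::real_normed_vector) \<Rightarrow> real \<times> real \<Rightarrow> real" where
  "area_element B X p = sqrt (metric_E B X p * metric_G B X p - (metric_F B X p)\<^sup>2)"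

text \<open>For the Euclidean inner product, positive definiteness just says that \<open>X\<close> is an immersion.\<close>

definition spacelike_surface ::
    "('a \<Rightarrow> 'a \<Rightarrow> real) \<Rightarrow> (real \<times> real) set \<Rightarrow> (real \<times> real \<Rightarrow> 'a::real_normed_vector) \<Rightarrow> bool"
  where
  "spacelike_surface B \<Omega> X \<longleftrightarrow>
     C2_on \<Omega> X \<and> (\<forall>p\<in>\<Omega>. \<forall>v. v \<noteq> 0 \<longrightarrow> 0 < induced_metric B X p v)"

text \<open>The \<open>B\<close>-orthogonal projection to the normal space; well defined wherever the induced metric
  is positive definite.\<close>

definition normal_part ::
    "('a \<Rightarrow> 'a \<Rightarrow> real) \<Rightarrow> (real \<times> real \<Rightarrow> 'a::real_normed_vector) \<Rightarrow> real \<times> real \<Rightarrow> 'a \<Rightarrow> 'a" where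
  "normal_part B X p v =
     (THE w. v - w \<in> span {partial_x X p, partial_y X p} \<and>
             (\<forall>u \<in> span {partial_x X p, partial_y X p}. B w u = 0))"

text \<open>Half the trace, with respect to the induced metric, of the vector-valued second fundamental
  form, which is the normal part of the second derivatives of \<open>X\<close>.\<close>

definition mean_curvature_vector ::
    "('a \<Rightarrow> 'a \<Rightarrow> real) \<Rightarrow> (real \<times> real \<Rightarrow> 'a::real_normed_vector) \<Rightarrow> real \<times> real \<Rightarrow> 'a" where
  "mean_curvature_vector B X p =
     (1 / (2 * (metric_E B X p * metric_G B X p - (metric_F B X p)\<^sup>2))) *\<^sub>R
       (metric_G B X p *\<^sub>R normal_part B X p (partial_x (partial_x X) p)
        - (2 * metric_F B X p) *\<^sub>R normal_part B X p (partial_y (partial_x X) p)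
        + metric_E B X p *\<^sub>R normal_part B X p (partial_y (partial_y X) p))"

section \<open>Minimal and maximal graphs\<close>

text \<open>The type \<open>real \<times> real \<times> (real ^ 'n)\<close> is $\mathbb{R}^{n+2}$: its library inner product is the
  Euclidean one. The following is the inner product of $\mathbb{R}^{n+2}_n$.\<close>

definition pseudo_inner :: "real \<times> real \<times> (real ^ 'n) \<Rightarrow> real \<times> real \<times> (real ^ 'n) \<Rightarrow> real" where
  "pseudo_inner u v =
     fst u * fst v + fst (snd u) * fst (snd v) - inner (snd (snd u)) (snd (snd v))"

definition minimal_surface ::
    "(real \<times> real) set \<Rightarrow> (real \<times> real \<Rightarrow> real \<times> real \<times> (real ^ 'n)) \<Rightarrow> bool" where
  "minimal_surface \<Omega> X \<longleftrightarrow>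
     spacelike_surface inner \<Omega> X \<and> (\<forall>p\<in>\<Omega>. mean_curvature_vector inner X p = 0)"

definition maximal_surface ::
    "(real \<times> real) set \<Rightarrow> (real \<times> real \<Rightarrow> real \<times> real \<times> (real ^ 'n)) \<Rightarrow> bool" where
  "maximal_surface \<Omega> X \<longleftrightarrow>
     spacelike_surface pseudo_inner \<Omega> X \<and> (\<forall>p\<in>\<Omega>. mean_curvature_vector pseudo_inner X p = 0)"

definition graph_map ::
    "'n::finite height_map \<Rightarrow> real \<times> real \<Rightarrow> real \<times> real \<times> (real ^ 'n)" where
  "graph_map \<phi> p = (fst p, snd p, \<phi> p)"

abbreviation "minimal_graph \<Omega> f \<equiv> minimal_surface \<Omega> (graph_map f)"
abbreviation "maximal_graph \<Omega> g \<equiv> maximal_surface \<Omega> (graph_map g)"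

abbreviation "min_E f \<equiv> metric_E inner (graph_map f)"
abbreviation "min_F f \<equiv> metric_F inner (graph_map f)"
abbreviation "min_G f \<equiv> metric_G inner (graph_map f)"
abbreviation "min_\<omega> f \<equiv> area_element inner (graph_map f)"

abbreviation "max_E g \<equiv> metric_E pseudo_inner (graph_map g)"
abbreviation "max_F g \<equiv> metric_F pseudo_inner (graph_map g)"
abbreviation "max_G g \<equiv> metric_G pseudo_inner (graph_map g)"
abbreviation "max_\<omega> g \<equiv> area_element pseudo_inner (graph_map g)"

section \<open>Twin relations\<close>

text \<open>\<open>twin_to_maximal f g p\<close> gives the gradient of \<open>g\<close> in terms of \<open>f\<close>, and
  \<open>twin_to_minimal g f p\<close> that of \<open>f\<close> in terms of \<open>g\<close>.\<close>

definition twin_to_maximal ::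
    "'n::finite height_map \<Rightarrow> 'n height_map \<Rightarrow> real \<times> real \<Rightarrow> bool" where
  "twin_to_maximal f g p \<longleftrightarrow>
     (\<forall>k. (partial_x (\<lambda>q. g q $ k) p, partial_y (\<lambda>q. g q $ k) p) =
       (- (min_E f p / min_\<omega> f p) * partial_y (\<lambda>q. f q $ k) p + min_F f p / min_\<omega> f p * partial_x (\<lambda>q. f q $ k) p,
        min_G f p / min_\<omega> f p * partial_x (\<lambda>q. f q $ k) p - min_F f p / min_\<omega> f p * partial_y (\<lambda>q. f q $ k) p))"

definition twin_to_minimal ::
    "'n::finite height_map \<Rightarrow> 'n height_map \<Rightarrow> real \<times> real \<Rightarrow> bool" where
  "twin_to_minimal g f p \<longleftrightarrow>
     (\<forall>k. (partial_x (\<lambda>q. f q $ k) p, partial_y (\<lambda>q. f q $ k) p) =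
       (max_E g p / max_\<omega> g p * partial_y (\<lambda>q. g q $ k) p - max_F g p / max_\<omega> g p * partial_x (\<lambda>q. g q $ k) p,
        - (max_G g p / max_\<omega> g p) * partial_x (\<lambda>q. g q $ k) p + max_F g p / max_\<omega> g p * partial_y (\<lambda>q. g q $ k) p))"

end

theory Submission
  imports Defs "HOL-Complex_Analysis.Riemann_Mapping"
begin

text \<open>Put $\alpha = E/\omega$, $\beta = F/\omega$, $\gamma = G/\omega$, so that
  $\alpha\gamma - \beta^2 = 1$. On a minimal or maximal graph the coordinates $x$ and $y$ are harmonic,
  that is, $\alpha_y = \beta_x$ and $\beta_y = \gamma_x$. Together with the graph equation this says
  that the right-hand side of the twin relations is a closed 1-form, so the twin exists on a simply
  connected domain. The twin has the same $\alpha$, $\beta$, $\gamma$, because its metric is the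
  original one multiplied by $(1 - \|\mathcal{J}\|^2)/\omega^2$; its graph equation then reduces to
  the derivatives of $\alpha\gamma - \beta^2 = 1$. The minimal and the maximal case differ only by
  the sign of the height part of the ambient inner product and are treated simultaneously.\<close>

text \<open>The twin relations are the Hodge star of the graph metric: they read dg = star df in one
  direction and df = - star dg in the other, so each g_k is a conjugate function of f_k. On a
  surface the star of a 1-form depends only on the conformal class of the metric, that is, on
  \<alpha>, \<beta>, \<gamma>, and its square is -1. Hence the relations can be reversed, and the
  correspondence is involutive, as soon as the twin metric is known to be conformal to the original
  one. The bound on the area-angle map enters as positivity of the conformal factor: it makes the
  twin metric positive definite for both signs of the ambient form. The regularity is tight: for a
  map of class C^2 the form to be integrated is only of class C^1. The integration is therefore done
  for C^1 forms, and their primitives are again of class C^2.\<close>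

section \<open>Closed 1-forms on simply connected planar domains\<close>

text \<open>Symmetry of the derivative is the condition dw = 0. Continuity is asked one direction at
  a time, which is easy to verify for concrete forms and in finite dimension amounts to continuity
  in the operator norm.\<close>

definition closed_form ::
    "'a::real_normed_vector set \<Rightarrow> ('a \<Rightarrow> 'a \<Rightarrow>\<^sub>L 'b::real_normed_vector) \<Rightarrow> bool" where
  "closed_form S w \<longleftrightarrow>
    (\<exists>D. (\<forall>p\<in>S. (w has_derivative D p) (at p)) \<and> (\<forall>h. continuous_on S (\<lambda>p. D p h)) \<and>
         (\<forall>p\<in>S. \<forall>h k. D p h k = D p k h))"

lemma closed_formI:
  fixes w :: "'a::real_normed_vector \<Rightarrow> 'a \<Rightarrow>\<^sub>L 'b::real_normed_vector"
  assumes "\<And>p. p \<in> S \<Longrightarrow> (w has_derivative D p) (at p)"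
    and "\<And>h. continuous_on S (\<lambda>p. D p h)"
    and "\<And>p h k. p \<in> S \<Longrightarrow> D p h k = D p k h"
  shows "closed_form S w"
  using assms unfolding closed_form_def by blast

lemma closed_formE:
  fixes w :: "'a::real_normed_vector \<Rightarrow> 'a \<Rightarrow>\<^sub>L 'b::real_normed_vector"
  assumes "closed_form S w"
  obtains D where "\<And>p. p \<in> S \<Longrightarrow> (w has_derivative D p) (at p)"
    and "\<And>h. continuous_on S (\<lambda>p. D p h)"
    and "\<And>p h k. p \<in> S \<Longrightarrow> D p h k = D p k h"
proof -
  from assms obtain D where "\<forall>p\<in>S. (w has_derivative D p) (at p)"
    "\<forall>h. continuous_on S (\<lambda>p. D p h)" "\<forall>p\<in>S. \<forall>h k. D p h k = D p k h"
    unfolding closed_form_def by blast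
  then show thesis by (intro that[of D]) auto
qed

lemma continuous_on_Blinfun:
  fixes D :: "'a::t2_space \<Rightarrow> 'b::euclidean_space \<Rightarrow> 'c::real_normed_vector"
  assumes "\<And>p. p \<in> S \<Longrightarrow> bounded_linear (D p)" "\<And>h. continuous_on S (\<lambda>p. D p h)"
  shows "continuous_on S (\<lambda>p. Blinfun (D p))"
proof (rule continuous_on_blinfun_componentwise)
  fix i :: 'b
  show "continuous_on S (\<lambda>p. Blinfun (D p) i)"
    using assms(2)[of i]
    by (rule continuous_on_eq) (simp add: assms(1) bounded_linear_Blinfun_apply)
qed

text \<open>The primitive is the integral of the form along the ray from 0 to z. Differentiation
  under the integral sign and closedness turn the integrand of its derivative into the t-derivative
  of t w(tz), and the fundamental theorem of calculus leaves w(z).\<close>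

lemma poincare_lemma_convex:
  fixes w :: "'a::euclidean_space \<Rightarrow> 'a \<Rightarrow>\<^sub>L 'b::banach"
  assumes "convex U" "open U" "0 \<in> U" "closed_form U w"
  obtains u where "\<And>p. p \<in> U \<Longrightarrow> (u has_derivative w p) (at p)"
proof -
  obtain D where D: "\<And>p. p \<in> U \<Longrightarrow> (w has_derivative D p) (at p)"
    "\<And>h. continuous_on U (\<lambda>p. D p h)" "\<And>p h k. p \<in> U \<Longrightarrow> D p h k = D p k h"
    using assms(4) by (rule closed_formE) blast
  define w' where "w' = (\<lambda>p. Blinfun (D p))"
  have bl: "bounded_linear (D p)" if "p \<in> U" for p
    using D(1)[OF that] has_derivative_bounded_linear by blast
  have w': "blinfun_apply (w' p) = D p" if "p \<in> U" for p
    unfolding w'_def using bl[OF that] by (rule bounded_linear_Blinfun_apply)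
  have cont': "continuous_on U w'"
    unfolding w'_def by (intro continuous_on_Blinfun bl D(2))
  have cont: "continuous_on U w"
    by (meson D(1) continuous_at_imp_continuous_on has_derivative_continuous)
  have sc: "t *\<^sub>R z \<in> U" if "z \<in> U" "t \<in> cbox 0 1" for t :: real and z
    using convexD[OF assms(1) that(1) assms(3), of t "1 - t"] that by auto
  \<comment> \<open>Read as a linear map, \<open>d z t\<close> is the derivative in z of the
    integrand w(tz) z, by symmetry of \<open>D\<close>; it is also the derivative in t of t w(tz).
    The two computations meet here.\<close>
  define d where "d = (\<lambda>z t. t *\<^sub>R w' (t *\<^sub>R z) z + w (t *\<^sub>R z))"
  define u where "u = (\<lambda>z. integral (cbox (0::real) 1) (\<lambda>t. w (t *\<^sub>R z) z))"
  have dd: "((\<lambda>z. w (t *\<^sub>R z) z) has_derivative d z t) (at z within U)"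
    if z: "z \<in> U" and t: "t \<in> cbox 0 1" for z and t :: real
  proof -
    have "((\<lambda>z. w (t *\<^sub>R z)) has_derivative (\<lambda>h. D (t *\<^sub>R z) (t *\<^sub>R h))) (at z within U)"
      by (rule has_derivative_compose[where f = "\<lambda>z. t *\<^sub>R z" and g = w, OF _ D(1)[OF sc[OF z t]]]) (auto intro!: derivative_eq_intros)
    from blinfun.FDERIV[OF this has_derivative_ident]
    have "((\<lambda>z. w (t *\<^sub>R z) z) has_derivative
        (\<lambda>h. w (t *\<^sub>R z) h + D (t *\<^sub>R z) (t *\<^sub>R h) z)) (at z within U)" .
    moreover have "w (t *\<^sub>R z) h + D (t *\<^sub>R z) (t *\<^sub>R h) z = d z t h" for h
      using D(3)[OF sc[OF z t], of h z] linear_scale[OF bounded_linear.linear[OF bl[OF sc[OF z t]]]]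
      by (simp add: d_def blinfun.bilinear_simps w'[OF sc[OF z t]])
    ultimately show ?thesis by (simp only:)
  qed
  have "(u has_derivative integral (cbox 0 1) (d z)) (at z within U)" if z: "z \<in> U" for z
    unfolding u_def
  proof (rule leibniz_rule[OF dd _ _ z assms(1)])
    show "(\<lambda>t. w (t *\<^sub>R x) x) integrable_on cbox 0 1" if "x \<in> U" for x
      by (intro integrable_continuous continuous_intros continuous_on_compose2[OF cont])
        (use sc that in auto)
    show "continuous_on (U \<times> cbox 0 1) (\<lambda>(x, t). d x t)"
      unfolding d_def split_beta
      by (intro continuous_intros continuous_on_compose2[OF cont] continuous_on_compose2[OF cont'])
        (use sc in auto)
  qed
  moreover have "integral (cbox 0 1) (d z) = w z" if z: "z \<in> U" for z
  proof -
    have "((\<lambda>t. t *\<^sub>R w (t *\<^sub>R z)) has_vector_derivative d z t) (at t within {0..1})"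
      if t: "t \<in> {0..1}" for t
    proof -
      have t': "t \<in> cbox 0 1" using t by simp
      have "((\<lambda>t. w (t *\<^sub>R z)) has_derivative (\<lambda>h. D (t *\<^sub>R z) (h *\<^sub>R z))) (at t within {0..1})"
        by (rule has_derivative_compose[where f = "\<lambda>t. t *\<^sub>R z" and g = w, OF _ D(1)[OF sc[OF z t']]]) (auto intro!: derivative_eq_intros)
      then have "((\<lambda>t. w (t *\<^sub>R z)) has_vector_derivative w' (t *\<^sub>R z) z) (at t within {0..1})"
        using linear_scale[OF bounded_linear.linear[OF bl[OF sc[OF z t']]]]
        by (simp add: has_vector_derivative_def w'[OF sc[OF z t']])
      from has_vector_derivative_scaleR[OF DERIV_ident this]
      show ?thesis by (simp add: d_def)
    qed
    then have "(d z has_integral (1 *\<^sub>R w (1 *\<^sub>R z) - 0 *\<^sub>R w (0 *\<^sub>R z))) {0..1}"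
      by (intro fundamental_theorem_of_calculus) auto
    then show ?thesis by (simp add: integral_unique)
  qed
  ultimately show ?thesis
    using that assms(2) by (metis at_within_open)
qed


text \<open>The derivative of the pullback has two terms. One is symmetric because w is closed, the
  other because the second derivative of \<open>g\<close> is symmetric; that \<open>g\<close> is of
  class C^2 is encoded by calling its derivative \<open>Dg\<close> a closed form.\<close>

lemma closed_form_pullback:
  fixes w :: "'a::euclidean_space \<Rightarrow> 'a \<Rightarrow>\<^sub>L 'b::real_normed_vector"
  assumes w: "closed_form S w" and Dg: "closed_form T Dg"
    and g: "\<And>p. p \<in> T \<Longrightarrow> (g has_derivative Dg p) (at p)" and gT: "g ` T \<subseteq> S"
  shows "closed_form T (\<lambda>p. w (g p) o\<^sub>L Dg p)"
proof -
  obtain D where D: "\<And>p. p \<in> S \<Longrightarrow> (w has_derivative D p) (at p)"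
    "\<And>h. continuous_on S (\<lambda>p. D p h)" "\<And>p h k. p \<in> S \<Longrightarrow> D p h k = D p k h"
    using w by (rule closed_formE) blast
  obtain H where H: "\<And>p. p \<in> T \<Longrightarrow> (Dg has_derivative H p) (at p)"
    "\<And>h. continuous_on T (\<lambda>p. H p h)" "\<And>p h k. p \<in> T \<Longrightarrow> H p h k = H p k h"
    using Dg by (rule closed_formE) blast
  have cg: "continuous_on T g" and cDg: "continuous_on T Dg"
    and cw: "continuous_on S w"
    by (meson g H D continuous_at_imp_continuous_on has_derivative_continuous)+
  show ?thesis
  proof (rule closed_formI)
    fix p assume p: "p \<in> T"
    have "((\<lambda>p. w (g p)) has_derivative (\<lambda>h. D (g p) (Dg p h))) (at p)"
      by (rule has_derivative_compose[OF g[OF p] D(1)]) (use p gT in auto)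
    from bounded_bilinear.FDERIV[OF bounded_bilinear_blinfun_compose this H(1)[OF p]]
    show "((\<lambda>p. w (g p) o\<^sub>L Dg p) has_derivative
        (\<lambda>h. (w (g p) o\<^sub>L H p h) + (D (g p) (Dg p h) o\<^sub>L Dg p))) (at p)" .
    show "((w (g p) o\<^sub>L H p h) + (D (g p) (Dg p h) o\<^sub>L Dg p)) k =
          ((w (g p) o\<^sub>L H p k) + (D (g p) (Dg p k) o\<^sub>L Dg p)) h" for h k
      using p gT H(3)[OF p, of h k] D(3)[of "g p" "Dg p h" "Dg p k"]
      by (auto simp: blinfun.bilinear_simps)
  next
    fix h
    \<comment> \<open>The direction \<open>Dg p h\<close> moves with p, so continuity of
      \<open>D\<close> in each fixed direction has to be upgraded to the operator norm before
      composing.\<close>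
    have bl: "bounded_linear (D p)" if "p \<in> S" for p
      using D(1)[OF that] has_derivative_bounded_linear by blast
    then have "continuous_on S (\<lambda>p. Blinfun (D p))"
      by (intro continuous_on_Blinfun D(2))
    then have "continuous_on T (\<lambda>p. Blinfun (D (g p)) (Dg p h))"
      by (intro continuous_intros cDg continuous_on_compose2[OF _ cg gT])
    then have "continuous_on T (\<lambda>p. D (g p) (Dg p h))"
      by (rule continuous_on_eq) (use bl gT in \<open>auto simp: bounded_linear_Blinfun_apply\<close>)
    then show "continuous_on T (\<lambda>p. (w (g p) o\<^sub>L H p h) + (D (g p) (Dg p h) o\<^sub>L Dg p))"
      by (intro continuous_intros bounded_bilinear.continuous_on[OF bounded_bilinear_blinfun_compose]
          H(2) cDg continuous_on_compose2[OF cw cg gT])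
  qed
qed

text \<open>The second derivative is multiplication by g'', and it is symmetric because complex
  multiplication commutes. This makes holomorphic maps admissible for the pullback.\<close>

lemma closed_form_deriv:
  fixes g :: "complex \<Rightarrow> complex"
  assumes "g holomorphic_on T" "open T"
  shows "closed_form T (\<lambda>z. blinfun_mult_right (deriv g z))"
proof (rule closed_formI)
  have g': "deriv g holomorphic_on T" using assms by (rule holomorphic_deriv)
  fix z assume z: "z \<in> T"
  have "(deriv g has_derivative (\<lambda>h. deriv (deriv g) z * h)) (at z)"
    using holomorphic_derivI[OF g' assms(2) z] has_field_derivative_imp_has_derivative by blast
  then show "((\<lambda>z. blinfun_mult_right (deriv g z)) has_derivative
      (\<lambda>h. blinfun_mult_right (deriv (deriv g) z * h))) (at z)"
    by (rule bounded_linear.has_derivative[OF bounded_linear_blinfun_mult_right])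
next
  fix h
  have "continuous_on T (deriv (deriv g))"
    using assms by (intro holomorphic_on_imp_continuous_on holomorphic_deriv)
  then show "continuous_on T (\<lambda>z. blinfun_mult_right (deriv (deriv g) z * h))"
    by (intro bounded_linear.continuous_on[OF bounded_linear_blinfun_mult_right] continuous_intros)
qed simp

lemma holomorphic_has_derivative_blinfun:
  assumes "g holomorphic_on T" "open T" "z \<in> T"
  shows "(g has_derivative blinfun_mult_right (deriv g z)) (at z)"
  using holomorphic_derivI[OF assms(1,2,3)] by (simp add: has_field_derivative_def)

text \<open>By the Riemann mapping theorem the domain may be replaced by the disc or the plane, where
  the radial primitive is available.\<close>

lemma poincare_lemma_complex:
  fixes w :: "complex \<Rightarrow> complex \<Rightarrow>\<^sub>L 'b::banach"
  assumes S: "open S" "simply_connected S" and w: "closed_form S w"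
  obtains u where "\<And>p. p \<in> S \<Longrightarrow> (u has_derivative w p) (at p)"
proof -
  consider "S = {}" | "S = UNIV" | f g where "f holomorphic_on S" "g holomorphic_on ball 0 1"
    "\<And>z. z \<in> S \<Longrightarrow> f z \<in> ball 0 1 \<and> g (f z) = z" "\<And>z. z \<in> ball 0 1 \<Longrightarrow> g z \<in> S"
    using S Riemann_mapping_theorem[of S] by blast
  then show ?thesis
  proof cases
    case 1
    then show ?thesis using that by blast
  next
    case 2
    then show ?thesis using poincare_lemma_convex[of S w] w that by auto
  next
    case (3 f g)
    \<comment> \<open>Forms move against the direction of a map: the inverse \<open>g\<close> of the
      Riemann map \<open>f\<close> carries the form to the disc, and \<open>f\<close> brings the
      potential back.\<close>
    have "closed_form (ball 0 1) (\<lambda>z. w (g z) o\<^sub>L blinfun_mult_right (deriv g z))"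
      by (intro closed_form_pullback[OF w closed_form_deriv] holomorphic_has_derivative_blinfun)
        (use 3 in auto)
    from poincare_lemma_convex[OF _ _ _ this]
    obtain u where u: "\<And>z. z \<in> ball 0 1 \<Longrightarrow>
        (u has_derivative (w (g z) o\<^sub>L blinfun_mult_right (deriv g z))) (at z)"
      by auto
    have "((\<lambda>z. u (f z)) has_derivative w p) (at p)" if p: "p \<in> S" for p
    proof -
      have "((\<lambda>z. u (f z)) has_derivative
          (\<lambda>h. (w (g (f p)) o\<^sub>L blinfun_mult_right (deriv g (f p))) (blinfun_mult_right (deriv f p) h)))
          (at p)"
        using 3 p S by (intro has_derivative_compose[OF holomorphic_has_derivative_blinfun u]) auto
      \<comment> \<open>The chain rule for g (f z) = z cancels the factor that the pullback has
        introduced, so the derivative of the transported potential is exactly w.\<close>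
      moreover have "deriv g (f p) * deriv f p = 1"
      proof -
        have "((\<lambda>z. g (f z)) has_field_derivative deriv g (f p) * deriv f p) (at p)"
          using 3 p S by (intro DERIV_chain2 holomorphic_derivI[of g "ball 0 1"] holomorphic_derivI[of f S]) auto
        moreover have "((\<lambda>z. g (f z)) has_field_derivative 1) (at p)"
          by (rule has_field_derivative_transform_within_open[OF DERIV_ident S(1) p]) (use 3 in auto)
        ultimately show ?thesis by (rule DERIV_unique)
      qed
      ultimately show ?thesis
        using 3(3)[OF p] by (simp add: mult.assoc[symmetric])
    qed
    with that show ?thesis by blast
  qed
qed

text \<open>The Riemann mapping theorem speaks of \<open>complex\<close>, so the form passes through
  the real-linear isomorphism \<open>L\<close>. The derivative of \<open>L\<close> is constant,
  hence a closed form, and the pullback lemma applies.\<close>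

lemma poincare_lemma_plane:
  fixes w :: "real \<times> real \<Rightarrow> (real \<times> real) \<Rightarrow>\<^sub>L 'b::banach"
  assumes S: "open S" "simply_connected S" and w: "closed_form S w"
  obtains u where "\<And>p. p \<in> S \<Longrightarrow> (u has_derivative w p) (at p)"
proof -
  define L where "L = (\<lambda>z. (Re z, Im z))"
  define M where "M = (\<lambda>p. Complex (fst p) (snd p))"
  have LM: "L (M p) = p" "M (L z) = z" for p z
    by (simp_all add: L_def M_def)
  have bL: "bounded_linear L"
    unfolding L_def by (intro bounded_linear_Pair bounded_linear_Re bounded_linear_Im)
  have M_eq: "M = (\<lambda>p. of_real (fst p) + \<i> * of_real (snd p))"
    by (auto simp: M_def complex_eq_iff)
  have bM: "bounded_linear M"
    unfolding M_eq
    by (intro bounded_linear_add bounded_linear_const_mult bounded_linear_compose[OF bounded_linear_of_real] bounded_linear_fst bounded_linear_snd)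
  have "S homeomorphic M ` S"
    by (rule homeomorphicI[of M _ _ L])
      (auto simp: LM image_image linear_continuous_on bL bM)
  then have "simply_connected (M ` S)"
    using S(2) homeomorphic_simply_connected_eq by blast
  moreover have MS: "M ` S = L -` S"
    unfolding set_eq_iff image_iff vimage_eq by (metis LM)
  then have "open (M ` S)"
    using S(1) by (simp add: open_vimage linear_continuous_on bL)
  moreover have "closed_form (M ` S) (\<lambda>p. w (L p) o\<^sub>L Blinfun L)"
  proof (rule closed_form_pullback[OF w])
    show "closed_form (M ` S) (\<lambda>p. Blinfun L)"
      by (rule closed_formI[of _ _ "\<lambda>_ _. 0"]) (auto intro!: derivative_eq_intros)
    show "(L has_derivative Blinfun L) (at p)" for p
      using bL by (simp add: bounded_linear_Blinfun_apply bounded_linear_imp_has_derivative)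
  qed (auto simp: LM)
  ultimately obtain u where u: "\<And>p. p \<in> M ` S \<Longrightarrow> (u has_derivative (w (L p) o\<^sub>L Blinfun L)) (at p)"
    using poincare_lemma_complex by blast
  have "((\<lambda>p. u (M p)) has_derivative w p) (at p)" if "p \<in> S" for p
    using has_derivative_compose[OF bounded_linear_imp_has_derivative[OF bM] u[of "M p"]] that
    by (auto simp: LM bounded_linear_Blinfun_apply[OF bL])
  with that show ?thesis by blast
qed

section \<open>Partial derivatives in the plane\<close>

text \<open>Class C^1 with the two partials named as arguments. When two such statements share an
  argument, an equation between derivatives is expressed without being written, for instance a_y =
  b_x or the symmetry of mixed partials.\<close>

definition has_partials ::
    "(real \<times> real) set \<Rightarrow> (real \<times> real \<Rightarrow> 'a::real_normed_vector) \<Rightarrow>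
      (real \<times> real \<Rightarrow> 'a) \<Rightarrow> (real \<times> real \<Rightarrow> 'a) \<Rightarrow> bool" where
  "has_partials S u ux uy \<longleftrightarrow>
    (\<forall>p\<in>S. (u has_derivative (\<lambda>h. fst h *\<^sub>R ux p + snd h *\<^sub>R uy p)) (at p)) \<and>
    continuous_on S ux \<and> continuous_on S uy"

lemma has_partialsI:
  assumes "\<And>p. p \<in> S \<Longrightarrow> (u has_derivative (\<lambda>h. fst h *\<^sub>R ux p + snd h *\<^sub>R uy p)) (at p)"
    and "continuous_on S ux" "continuous_on S uy"
  shows "has_partials S u ux uy"
  using assms unfolding has_partials_def by blast

lemma has_partialsD:
  assumes "has_partials S u ux uy"
  shows "p \<in> S \<Longrightarrow> (u has_derivative (\<lambda>h. fst h *\<^sub>R ux p + snd h *\<^sub>R uy p)) (at p)"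
    and "continuous_on S ux" "continuous_on S uy" "continuous_on S u"
proof -
  show D: "(u has_derivative (\<lambda>h. fst h *\<^sub>R ux p + snd h *\<^sub>R uy p)) (at p)" if "p \<in> S" for p
    using assms that unfolding has_partials_def by blast
  show "continuous_on S ux" "continuous_on S uy"
    using assms unfolding has_partials_def by blast+
  show "continuous_on S u"
    using D by (meson continuous_at_imp_continuous_on has_derivative_continuous)
qed

lemma has_partials_cong:
  assumes u: "has_partials S u ux uy" and S: "open S"
    and eq: "\<And>p. p \<in> S \<Longrightarrow> v p = u p" "\<And>p. p \<in> S \<Longrightarrow> vx p = ux p" "\<And>p. p \<in> S \<Longrightarrow> vy p = uy p"
  shows "has_partials S v vx vy"
proof (rule has_partialsI)
  fix p assume p: "p \<in> S"
  show "(v has_derivative (\<lambda>h. fst h *\<^sub>R vx p + snd h *\<^sub>R vy p)) (at p)"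
    unfolding eq(2,3)[OF p]
    by (rule has_derivative_transform_within_open[OF has_partialsD(1)[OF u p] S p]) (simp add: eq)
next
  show "continuous_on S vx" "continuous_on S vy"
    using has_partialsD(2,3)[OF u] eq(2,3) by (simp_all cong: continuous_on_cong)
qed

lemma has_partials_const: "has_partials S (\<lambda>_. c) (\<lambda>_. 0) (\<lambda>_. 0)"
  by (rule has_partialsI) simp_all

lemma has_partials_fst: "has_partials S fst (\<lambda>_. 1) (\<lambda>_. 0)"
  by (rule has_partialsI) (simp_all add: bounded_linear_imp_has_derivative bounded_linear_fst)

lemma has_partials_snd: "has_partials S snd (\<lambda>_. 0) (\<lambda>_. 1)"
  by (rule has_partialsI) (simp_all add: bounded_linear_imp_has_derivative bounded_linear_snd)

lemma has_partials_add:
  assumes u: "has_partials S u ux uy" and v: "has_partials S v vx vy"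
  shows "has_partials S (\<lambda>p. u p + v p) (\<lambda>p. ux p + vx p) (\<lambda>p. uy p + vy p)"
proof (rule has_partialsI)
  show "((\<lambda>p. u p + v p) has_derivative (\<lambda>h. fst h *\<^sub>R (ux p + vx p) + snd h *\<^sub>R (uy p + vy p))) (at p)"
    if "p \<in> S" for p
    by (rule has_derivative_eq_rhs[OF has_derivative_add[OF has_partialsD(1)[OF u that] has_partialsD(1)[OF v that]]])
      (simp add: scaleR_add_right add_ac)
qed (intro continuous_intros has_partialsD(2,3)[OF u] has_partialsD(2,3)[OF v])+

lemma has_partials_diff:
  assumes u: "has_partials S u ux uy" and v: "has_partials S v vx vy"
  shows "has_partials S (\<lambda>p. u p - v p) (\<lambda>p. ux p - vx p) (\<lambda>p. uy p - vy p)"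
proof (rule has_partialsI)
  show "((\<lambda>p. u p - v p) has_derivative (\<lambda>h. fst h *\<^sub>R (ux p - vx p) + snd h *\<^sub>R (uy p - vy p))) (at p)"
    if "p \<in> S" for p
    by (rule has_derivative_eq_rhs[OF has_derivative_diff[OF has_partialsD(1)[OF u that] has_partialsD(1)[OF v that]]])
      (simp add: scaleR_diff_right add_diff_add)
qed (intro continuous_intros has_partialsD(2,3)[OF u] has_partialsD(2,3)[OF v])+

lemma has_partials_Pair:
  assumes u: "has_partials S u ux uy" and v: "has_partials S v vx vy"
  shows "has_partials S (\<lambda>p. (u p, v p)) (\<lambda>p. (ux p, vx p)) (\<lambda>p. (uy p, vy p))"
proof (rule has_partialsI)
  show "((\<lambda>p. (u p, v p)) has_derivative (\<lambda>h. fst h *\<^sub>R (ux p, vx p) + snd h *\<^sub>R (uy p, vy p))) (at p)"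
    if "p \<in> S" for p
    by (rule has_derivative_eq_rhs[OF has_derivative_Pair[OF has_partialsD(1)[OF u that] has_partialsD(1)[OF v that]]])
      simp
qed (intro continuous_intros has_partialsD(2,3)[OF u] has_partialsD(2,3)[OF v])+

lemma has_partials_bounded_bilinear:
  assumes "bounded_bilinear B" "has_partials S u ux uy" "has_partials S v vx vy"
  shows "has_partials S (\<lambda>p. B (u p) (v p)) (\<lambda>p. B (u p) (vx p) + B (ux p) (v p))
    (\<lambda>p. B (u p) (vy p) + B (uy p) (v p))"
proof -
  interpret bounded_bilinear B by fact
  note u = has_partialsD[OF assms(2)] and v = has_partialsD[OF assms(3)]
  show ?thesis
  proof (rule has_partialsI)
    show "((\<lambda>p. B (u p) (v p)) has_derivative (\<lambda>h. fst h *\<^sub>R (B (u p) (vx p) + B (ux p) (v p)) +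
        snd h *\<^sub>R (B (u p) (vy p) + B (uy p) (v p)))) (at p)" if "p \<in> S" for p
      by (rule has_derivative_eq_rhs[OF FDERIV[OF u(1)[OF that] v(1)[OF that]]])
        (simp add: add_left add_right scaleR_left scaleR_right scaleR_add_right add_ac)
  qed (intro continuous_on_add continuous_on u v)+
qed

lemmas has_partials_scaleR = has_partials_bounded_bilinear[OF bounded_bilinear_scaleR]
lemmas has_partials_mult = has_partials_bounded_bilinear[OF bounded_bilinear_mult]
lemmas has_partials_inner = has_partials_bounded_bilinear[OF bounded_bilinear_inner]

lemma has_partials_real_compose:
  fixes u :: "real \<times> real \<Rightarrow> real"
  assumes "has_partials S u ux uy"
    and r: "\<And>p. p \<in> S \<Longrightarrow> (r has_real_derivative r' p) (at (u p))"
    and "continuous_on S r'"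
  shows "has_partials S (\<lambda>p. r (u p)) (\<lambda>p. r' p * ux p) (\<lambda>p. r' p * uy p)"
proof -
  note u = has_partialsD[OF assms(1)]
  show ?thesis
    unfolding has_partials_def
  proof (intro conjI ballI continuous_intros u assms(3))
    fix p assume p: "p \<in> S"
    show "((\<lambda>p. r (u p)) has_derivative (\<lambda>h. fst h *\<^sub>R (r' p * ux p) + snd h *\<^sub>R (r' p * uy p))) (at p)"
      by (rule has_derivative_eq_rhs[OF has_derivative_compose
            [OF u(1)[OF p] r[OF p, unfolded has_field_derivative_def]]])
        (simp add: algebra_simps)
  qed
qed

lemma has_vector_derivative_partials:
  assumes "(u has_derivative (\<lambda>h. fst h *\<^sub>R a + snd h *\<^sub>R b)) (at p)"
  shows "((\<lambda>t. u (t, snd p)) has_vector_derivative a) (at (fst p))"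
    and "((\<lambda>t. u (fst p, t)) has_vector_derivative b) (at (snd p))"
proof -
  have "((\<lambda>t. (t, snd p)) has_derivative (\<lambda>t. (t, 0))) (at (fst p))"
    "((\<lambda>t. (fst p, t)) has_derivative (\<lambda>t. (0, t))) (at (snd p))"
    by (auto intro!: derivative_eq_intros)
  from has_derivative_compose[OF this(1), of u] has_derivative_compose[OF this(2), of u] assms
  show "((\<lambda>t. u (t, snd p)) has_vector_derivative a) (at (fst p))"
    "((\<lambda>t. u (fst p, t)) has_vector_derivative b) (at (snd p))"
    by (fastforce simp: has_vector_derivative_def)+
qed

lemma partial_eqI:
  assumes "(u has_derivative (\<lambda>h. fst h *\<^sub>R a + snd h *\<^sub>R b)) (at p)"
  shows "partial_x u p = a" "partial_y u p = b"
  using has_vector_derivative_partials[OF assms]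
  by (auto simp: partial_x_def partial_y_def vector_derivative_at)

lemma has_partials_imp_partial_eq:
  assumes "has_partials S u ux uy" "p \<in> S"
  shows "partial_x u p = ux p" "partial_y u p = uy p"
  using partial_eqI[OF has_partialsD(1)[OF assms]] by auto

text \<open>The integral of b(x, t) over t from y0 to y equals u(x, y) - u(x, y0). Its x-derivative
  at x0 is the integral of \<open>byx\<close> by the Leibniz rule, and also a(x0, y) - a(x0, y0).
  Differentiating both in y at y0 compares \<open>byx\<close> with \<open>axy\<close>.\<close>

lemma mixed_partials_equal:
  fixes u :: "real \<times> real \<Rightarrow> 'a::banach"
  assumes S: "open S" and u: "has_partials S u a b"
    and a: "has_partials S a axx axy" and b: "has_partials S b byx byy"
    and z: "z \<in> S"
  shows "axy z = byx z"
proof -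
  obtain x0 y0 where z_eq: "z = (x0, y0)" by (cases z)
  obtain r where r: "r > 0" "ball z r \<subseteq> S"
    using S z by (meson open_contains_ball)
  \<comment> \<open>The coordinate differences from \<open>z\<close> to a point of the box add up to
    at most r / 2, so the box stays inside the ball.\<close>
  define e where "e = r / 4"
  have e: "e > 0" using r by (simp add: e_def)
  define X where "X = {x0 - e<..<x0 + e}"
  \<comment> \<open>One-sided in y, so that every integral starts at the lower end y0; a derivative
    within a nondegenerate closed interval is unique at the endpoint too.\<close>
  define Y where "Y = {y0..y0 + e}"
  have box: "(x, y) \<in> S" if "x \<in> X" "y \<in> Y" for x y
  proof -
    have "dist z (x, y) \<le> \<bar>x0 - x\<bar> + \<bar>y0 - y\<bar>"
      using sqrt_sum_squares_le_sum_abs[of "x0 - x" "y0 - y"]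
      by (simp add: z_eq dist_Pair_Pair dist_real_def)
    also have "\<dots> < r" using that r by (auto simp: X_def Y_def e_def)
    finally show ?thesis using r by auto
  qed
  have X0: "x0 \<in> X" "open X" "convex X" using e by (auto simp: X_def)
  have sub: "t \<in> Y" if "y \<in> Y" "t \<in> {y0..y}" for y t using that by (auto simp: Y_def)
  have eq: "a (x0, y) - a (x0, y0) = integral {y0..y} (\<lambda>t. byx (x0, t))" if y: "y \<in> Y" for y
  proof -
    have int: "integral {y0..y} (\<lambda>t. b (x, t)) = u (x, y) - u (x, y0)" if x: "x \<in> X" for x
    proof (rule integral_unique, rule fundamental_theorem_of_calculus)
      show "y0 \<le> y" using y by (simp add: Y_def)
      fix t assume "t \<in> {y0..y}"
      then have "(x, t) \<in> S" using box x sub y by blast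
      from has_vector_derivative_partials(2)[OF has_partialsD(1)[OF u this]]
      show "((\<lambda>t. u (x, t)) has_vector_derivative b (x, t)) (at t within {y0..y})"
        by (simp add: has_vector_derivative_at_within)
    qed
    have "((\<lambda>x. integral (cbox y0 y) (\<lambda>t. b (x, t))) has_vector_derivative
        integral (cbox y0 y) (\<lambda>t. byx (x0, t))) (at x0 within X)"
    proof (rule leibniz_rule_vector_derivative[OF _ _ _ X0(1,3)])
      fix x t assume xt: "x \<in> X" "t \<in> cbox y0 y"
      then have "(x, t) \<in> S" using box sub y by auto
      from has_vector_derivative_partials(1)[OF has_partialsD(1)[OF b this]]
      show "((\<lambda>x. b (x, t)) has_vector_derivative byx (x, t)) (at x within X)"
        by (simp add: has_vector_derivative_at_within)
    next
      fix x assume x: "x \<in> X"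
      show "(\<lambda>t. b (x, t)) integrable_on cbox y0 y"
        by (intro integrable_continuous continuous_on_compose2[OF has_partialsD(4)[OF b]] continuous_intros)
          (use box sub y x in auto)
    next
      show "continuous_on (X \<times> cbox y0 y) (\<lambda>(x, t). byx (x, t))"
        by (simp, intro continuous_on_compose2[OF has_partialsD(2)[OF b]] continuous_intros)
          (use box sub y in auto)
    qed
    then have "((\<lambda>x. integral {y0..y} (\<lambda>t. b (x, t))) has_vector_derivative
        integral {y0..y} (\<lambda>t. byx (x0, t))) (at x0)"
      by (simp add: at_within_open[OF X0(1,2)])
    then have "((\<lambda>x. u (x, y) - u (x, y0)) has_vector_derivative
        integral {y0..y} (\<lambda>t. byx (x0, t))) (at x0)"
      by (rule has_vector_derivative_transform_within_open[OF _ X0(2,1)]) (simp add: int)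
    moreover have "((\<lambda>x. u (x, y) - u (x, y0)) has_vector_derivative a (x0, y) - a (x0, y0)) (at x0)"
      using has_vector_derivative_partials(1)[OF has_partialsD(1)[OF u box[OF X0(1) y]]]
        has_vector_derivative_partials(1)[OF has_partialsD(1)[OF u z]]
      by (auto simp: z_eq intro!: derivative_intros)
    ultimately show ?thesis using vector_derivative_unique_at by blast
  qed
  have "((\<lambda>y. integral {y0..y} (\<lambda>t. byx (x0, t))) has_vector_derivative byx (x0, y0)) (at y0 within {y0..y0 + e})"
    by (rule integral_has_vector_derivative, intro continuous_on_compose2[OF has_partialsD(2)[OF b]] continuous_intros)
      (use box X0 e in \<open>auto simp: Y_def\<close>)
  then have "((\<lambda>y. a (x0, y) - a (x0, y0)) has_vector_derivative byx (x0, y0)) (at y0 within {y0..y0 + e})"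
    by (rule has_vector_derivative_transform[rotated 2]) (use eq e in \<open>auto simp: Y_def\<close>)
  moreover have "((\<lambda>y. a (x0, y) - a (x0, y0)) has_vector_derivative axy (x0, y0)) (at y0 within {y0..y0 + e})"
    using has_vector_derivative_diff[OF has_vector_derivative_partials(2)[OF has_partialsD(1)[OF a z]]
        has_vector_derivative_const[of "a (x0, y0)"]]
    by (simp add: z_eq has_vector_derivative_at_within)
  ultimately show ?thesis
    using vector_derivative_unique_within_closed_interval[of y0 "y0 + e" y0] e z_eq by auto
qed

section \<open>The 1-form a dx + b dy, its potentials, and class C^2\<close>

definition gradient_form :: "'a::real_normed_vector \<Rightarrow> 'a \<Rightarrow> (real \<times> real) \<Rightarrow>\<^sub>L 'a" where
  "gradient_form a b = (blinfun_scaleR_left a o\<^sub>L fst_blinfun) + (blinfun_scaleR_left b o\<^sub>L snd_blinfun)"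

lemma gradient_form_apply: "blinfun_apply (gradient_form a b) = (\<lambda>h. fst h *\<^sub>R a + snd h *\<^sub>R b)"
  by (rule ext) (simp add: gradient_form_def blinfun.bilinear_simps)

lemma blinfun_plane_split:
  fixes A :: "(real \<times> real) \<Rightarrow>\<^sub>L 'a::real_normed_vector"
  shows "blinfun_apply A = (\<lambda>h. fst h *\<^sub>R A (1, 0) + snd h *\<^sub>R A (0, 1))"
proof (rule ext)
  fix h :: "real \<times> real"
  have "h = fst h *\<^sub>R (1, 0) + snd h *\<^sub>R (0, 1)" by (simp add: prod_eq_iff)
  then have "A h = A (fst h *\<^sub>R (1, 0) + snd h *\<^sub>R (0, 1))" by simp
  then show "A h = fst h *\<^sub>R A (1, 0) + snd h *\<^sub>R A (0, 1)"
    by (simp only: blinfun.add_right blinfun.scaleR_right)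
qed

text \<open>The shared \<open>m\<close> is the closedness condition a_y = b_x: both mixed
  coefficients of the derivative are equal to it, which makes the derivative symmetric.\<close>

lemma closed_form_gradient_form:
  assumes a: "has_partials S a p m" and b: "has_partials S b m q"
  shows "closed_form S (\<lambda>z. gradient_form (a z) (b z))"
proof (rule closed_formI[where D = "\<lambda>z h. gradient_form (fst h *\<^sub>R p z + snd h *\<^sub>R m z) (fst h *\<^sub>R m z + snd h *\<^sub>R q z)"])
  have bl: "bounded_linear (\<lambda>v. gradient_form (fst v) (snd v))"
    unfolding gradient_form_def
    by (intro bounded_linear_add
        bounded_linear_compose[OF bounded_bilinear.bounded_linear_left[OF bounded_bilinear_blinfun_compose]]
        bounded_linear_compose[OF bounded_linear_blinfun_scaleR_left] bounded_linear_fst bounded_linear_snd)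
  show "((\<lambda>z. gradient_form (a z) (b z)) has_derivative
      (\<lambda>h. gradient_form (fst h *\<^sub>R p z + snd h *\<^sub>R m z) (fst h *\<^sub>R m z + snd h *\<^sub>R q z))) (at z)"
    if "z \<in> S" for z
    using bounded_linear.has_derivative[OF bl has_derivative_Pair
        [OF has_partialsD(1)[OF a that] has_partialsD(1)[OF b that]]] by simp
  show "continuous_on S (\<lambda>z. gradient_form (fst h *\<^sub>R p z + snd h *\<^sub>R m z) (fst h *\<^sub>R m z + snd h *\<^sub>R q z))" for h
    using has_partialsD(2,3)[OF a] has_partialsD(2,3)[OF b]
      bounded_linear.continuous_on[OF bl, of S "\<lambda>z. (fst h *\<^sub>R p z + snd h *\<^sub>R m z, fst h *\<^sub>R m z + snd h *\<^sub>R q z)"]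
    by (simp add: continuous_intros)
qed (simp add: gradient_form_apply algebra_simps)

text \<open>A primitive has one derivative more than its form; the derivative of the form serves as
  the second derivative. This gives the twin its regularity.\<close>

lemma closed_form_imp_C2_on:
  fixes w :: "'a::euclidean_space \<Rightarrow> 'a \<Rightarrow>\<^sub>L 'b::real_normed_vector"
  assumes "closed_form S w" and u: "\<And>p. p \<in> S \<Longrightarrow> (u has_derivative w p) (at p)"
  shows "C2_on S u"
proof -
  obtain D where D: "\<And>p. p \<in> S \<Longrightarrow> (w has_derivative D p) (at p)" "\<And>h. continuous_on S (\<lambda>p. D p h)"
    using assms(1) by (rule closed_formE) blast
  have bl: "bounded_linear (D p)" if "p \<in> S" for p
    using D(1)[OF that] has_derivative_bounded_linear by blast
  show ?thesis
    unfolding C2_on_def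
  proof (intro exI[of _ w] exI[of _ "\<lambda>p. Blinfun (D p)"] conjI ballI u)
    show "(w has_derivative Blinfun (D p)) (at p)" if "p \<in> S" for p
      using D(1) bl that by (simp add: bounded_linear_Blinfun_apply)
    show "continuous_on S (\<lambda>p. Blinfun (D p))"
      by (intro continuous_on_Blinfun bl D)
  qed
qed

lemma has_partials_imp_C2_on:
  assumes "has_partials S u a b" "has_partials S a p m" "has_partials S b m q"
  shows "C2_on S u"
  using closed_form_imp_C2_on[OF closed_form_gradient_form[OF assms(2,3)], of u] has_partialsD(1)[OF assms(1)]
  by (simp add: gradient_form_apply)

text \<open>The third conclusion contains the symmetry of the second derivatives: the x-partial of
  \<open>partial_y u\<close> is recorded as \<open>partial_y (partial_x u)\<close>.\<close>

lemma C2_on_imp_has_partials: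
  fixes u :: "real \<times> real \<Rightarrow> 'a::banach"
  assumes S: "open S" and "C2_on S u"
  shows "has_partials S u (partial_x u) (partial_y u)"
    and "has_partials S (partial_x u) (partial_x (partial_x u)) (partial_y (partial_x u))"
    and "has_partials S (partial_y u) (partial_y (partial_x u)) (partial_y (partial_y u))"
proof -
  obtain D1 D2 where D1: "\<And>p. p \<in> S \<Longrightarrow> (u has_derivative blinfun_apply (D1 p)) (at p)"
    and D2: "\<And>p. p \<in> S \<Longrightarrow> (D1 has_derivative blinfun_apply (D2 p)) (at p)" "continuous_on S D2"
    using assms(2) unfolding C2_on_def by blast
  have cD1: "continuous_on S D1"
    by (meson D2(1) continuous_at_imp_continuous_on has_derivative_continuous)
  have u: "has_partials S u (\<lambda>p. D1 p (1, 0)) (\<lambda>p. D1 p (0, 1))"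
    unfolding has_partials_def
    using D1 by (intro conjI ballI continuous_intros cD1) (simp add: blinfun_plane_split[symmetric])
  have D1': "has_partials S (\<lambda>p. D1 p v) (\<lambda>p. D2 p (1, 0) v) (\<lambda>p. D2 p (0, 1) v)" for v
    unfolding has_partials_def
  proof (intro conjI ballI continuous_intros D2(2))
    fix p assume p: "p \<in> S"
    have "((\<lambda>p. D1 p v) has_derivative (\<lambda>h. D2 p h v)) (at p)"
      using blinfun.FDERIV[OF D2(1)[OF p] has_derivative_const[of v]] by simp
    moreover have "(\<lambda>h. D2 p h v) = (\<lambda>h. fst h *\<^sub>R D2 p (1, 0) v + snd h *\<^sub>R D2 p (0, 1) v)"
      by (subst blinfun_plane_split[of "D2 p"]) (simp add: blinfun.bilinear_simps)
    ultimately show "((\<lambda>p. D1 p v) has_derivative (\<lambda>h. fst h *\<^sub>R D2 p (1, 0) v + snd h *\<^sub>R D2 p (0, 1) v)) (at p)"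
      by (rule has_derivative_eq_rhs)
  qed
  note eq1 = has_partials_imp_partial_eq[OF u]
  show u': "has_partials S u (partial_x u) (partial_y u)"
    using u S by (rule has_partials_cong) (simp_all add: eq1)
  have x: "has_partials S (partial_x u) (\<lambda>p. D2 p (1, 0) (1, 0)) (\<lambda>p. D2 p (0, 1) (1, 0))"
    using D1'[of "(1, 0)"] S by (rule has_partials_cong) (simp_all add: eq1)
  have y: "has_partials S (partial_y u) (\<lambda>p. D2 p (1, 0) (0, 1)) (\<lambda>p. D2 p (0, 1) (0, 1))"
    using D1'[of "(0, 1)"] S by (rule has_partials_cong) (simp_all add: eq1)
  note eq2 = has_partials_imp_partial_eq[OF x] has_partials_imp_partial_eq[OF y]
  show "has_partials S (partial_x u) (partial_x (partial_x u)) (partial_y (partial_x u))"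
    using x S by (rule has_partials_cong) (simp_all add: eq2)
  show "has_partials S (partial_y u) (partial_y (partial_x u)) (partial_y (partial_y u))"
    using y S by (rule has_partials_cong) (simp_all add: eq2 mixed_partials_equal[OF S u' x y])
qed

lemma exists_potential:
  fixes a :: "real \<times> real \<Rightarrow> 'a::banach"
  assumes "open S" "simply_connected S"
    and a: "has_partials S a p m" and b: "has_partials S b m q"
  obtains u where "has_partials S u a b"
proof -
  obtain u where "\<And>z. z \<in> S \<Longrightarrow> (u has_derivative gradient_form (a z) (b z)) (at z)"
    by (rule poincare_lemma_plane[OF assms(1,2) closed_form_gradient_form[OF a b]]) blast
  then have "has_partials S u a b"
    using has_partialsD(4)[OF a] has_partialsD(4)[OF b]
    unfolding has_partials_def gradient_form_apply by (intro conjI ballI)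
  with that show ?thesis by blast
qed

section \<open>Graphs in $\mathbb{R}^{n+2}$ and $\mathbb{R}^{n+2}_n$\<close>

definition signed_inner ::
    "real \<Rightarrow> real \<times> real \<times> (real ^ 'n) \<Rightarrow> real \<times> real \<times> (real ^ 'n) \<Rightarrow> real" where
  "signed_inner s u v =
     fst u * fst v + fst (snd u) * fst (snd v) + s * inner (snd (snd u)) (snd (snd v))"

lemma inner_eq_signed_inner: "(inner :: real \<times> real \<times> (real ^ 'n) \<Rightarrow> _) = signed_inner 1"
  by (intro ext) (simp add: signed_inner_def inner_prod_def)

lemma pseudo_inner_eq_signed_inner: "pseudo_inner = signed_inner (- 1)"
  by (intro ext) (simp add: signed_inner_def pseudo_inner_def)

definition critical_graph :: "real \<Rightarrow> (real \<times> real) set \<Rightarrow> 'n::finite height_map \<Rightarrow> bool" where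
  "critical_graph s \<Omega> \<phi> \<longleftrightarrow>
     spacelike_surface (signed_inner s) \<Omega> (graph_map \<phi>) \<and>
     (\<forall>p\<in>\<Omega>. mean_curvature_vector (signed_inner s) (graph_map \<phi>) p = 0)"

lemma minimal_graph_eq_critical_graph: "minimal_graph \<Omega> f \<longleftrightarrow> critical_graph 1 \<Omega> f"
  by (simp add: minimal_surface_def critical_graph_def inner_eq_signed_inner)

lemma maximal_graph_eq_critical_graph: "maximal_graph \<Omega> g \<longleftrightarrow> critical_graph (- 1) \<Omega> g"
  by (simp add: maximal_surface_def critical_graph_def pseudo_inner_eq_signed_inner)

lemma has_partials_graph_map:
  assumes "has_partials S \<phi> a b"
  shows "has_partials S (graph_map \<phi>) (\<lambda>p. (1, 0, a p)) (\<lambda>p. (0, 1, b p))"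
  using has_partials_Pair[OF has_partials_fst has_partials_Pair[OF has_partials_snd assms]]
  unfolding graph_map_def[abs_def] .

lemma partials_graph_map:
  fixes \<phi> :: "'n::finite height_map"
  assumes S: "open S" and \<phi>: "C2_on S \<phi>" and p: "p \<in> S"
  shows "partial_x (graph_map \<phi>) p = (1, 0, partial_x \<phi> p)"
    and "partial_y (graph_map \<phi>) p = (0, 1, partial_y \<phi> p)"
    and "partial_x (partial_x (graph_map \<phi>)) p = (0, 0, partial_x (partial_x \<phi>) p)"
    and "partial_y (partial_x (graph_map \<phi>)) p = (0, 0, partial_y (partial_x \<phi>) p)"
    and "partial_y (partial_y (graph_map \<phi>)) p = (0, 0, partial_y (partial_y \<phi>) p)"
proof -
  note h = C2_on_imp_has_partials[OF S \<phi>]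
  note 1 = has_partials_graph_map[OF h(1)]
  note eq = has_partials_imp_partial_eq[OF 1]
  show "partial_x (graph_map \<phi>) p = (1, 0, partial_x \<phi> p)"
    "partial_y (graph_map \<phi>) p = (0, 1, partial_y \<phi> p)"
    using eq p by auto
  note x = has_partials_Pair[OF has_partials_const[of S "1::real"]
      has_partials_Pair[OF has_partials_const[of S "0::real"] h(2)]]
  note y = has_partials_Pair[OF has_partials_const[of S "0::real"]
      has_partials_Pair[OF has_partials_const[of S "1::real"] h(3)]]
  note x' = has_partials_cong[OF x S eq(1) refl refl]
  note y' = has_partials_cong[OF y S eq(2) refl refl]
  show "partial_x (partial_x (graph_map \<phi>)) p = (0, 0, partial_x (partial_x \<phi>) p)"
    "partial_y (partial_x (graph_map \<phi>)) p = (0, 0, partial_y (partial_x \<phi>) p)"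
    "partial_y (partial_y (graph_map \<phi>)) p = (0, 0, partial_y (partial_y \<phi>) p)"
    using has_partials_imp_partial_eq[OF x' p] has_partials_imp_partial_eq[OF y' p] by auto
qed

lemma C2_on_graph_map:
  fixes \<phi> :: "'n::finite height_map"
  assumes S: "open S" and \<phi>: "C2_on S \<phi>"
  shows "C2_on S (graph_map \<phi>)"
proof -
  note h = C2_on_imp_has_partials[OF S \<phi>]
  show ?thesis
    by (rule has_partials_imp_C2_on[OF has_partials_graph_map[OF h(1)]
          has_partials_Pair[OF has_partials_const has_partials_Pair[OF has_partials_const h(2)]]
          has_partials_Pair[OF has_partials_const has_partials_Pair[OF has_partials_const h(3)]]])
qed

section \<open>First fundamental form, mean curvature and the graph equation\<close>

lemma metric_graph_map:
  assumes "open S" "C2_on S \<phi>" "p \<in> S"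
  shows "metric_E (signed_inner s) (graph_map \<phi>) p = 1 + s * (partial_x \<phi> p \<bullet> partial_x \<phi> p)"
    and "metric_F (signed_inner s) (graph_map \<phi>) p = s * (partial_x \<phi> p \<bullet> partial_y \<phi> p)"
    and "metric_G (signed_inner s) (graph_map \<phi>) p = 1 + s * (partial_y \<phi> p \<bullet> partial_y \<phi> p)"
  by (simp_all add: metric_E_def metric_F_def metric_G_def signed_inner_def partials_graph_map[OF assms])

text \<open>Sylvester's criterion for a binary form, by completing the square after multiplication
  with E.\<close>

lemma induced_metric_pos_iff:
  "(\<forall>v. v \<noteq> 0 \<longrightarrow> 0 < induced_metric B X p v) \<longleftrightarrow>
     0 < metric_E B X p \<and> 0 < metric_E B X p * metric_G B X p - (metric_F B X p)\<^sup>2"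
  (is "?L \<longleftrightarrow> ?R")
proof -
  define E F G where "E = metric_E B X p" and "F = metric_F B X p" and "G = metric_G B X p"
  have q: "induced_metric B X p v = E * (fst v)\<^sup>2 + 2 * F * fst v * snd v + G * (snd v)\<^sup>2" for v
    by (simp add: induced_metric_def E_def F_def G_def)
  show ?thesis
  proof
    assume L: ?L
    have E: "0 < E" using L[rule_format, of "(1, 0)"] by (simp add: q zero_prod_def)
    \<comment> \<open>The vector \<open>(- F, E)\<close> is orthogonal to \<open>(1, 0)\<close> for
      the induced metric, so its square isolates the determinant.\<close>
    have "0 < induced_metric B X p (- F, E)" using L E by (auto simp: zero_prod_def)
    also have "\<dots> = E * (E * G - F\<^sup>2)" by (simp add: q power2_eq_square algebra_simps)
    finally show ?R using E by (simp add: zero_less_mult_iff E_def F_def G_def)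
  next
    assume R: ?R
    show ?L
    proof (intro allI impI)
      fix v :: "real \<times> real" assume v: "v \<noteq> 0"
      have E: "0 < E" and D: "0 < E * G - F\<^sup>2" using R by (auto simp: E_def F_def G_def)
      have "E * induced_metric B X p v = (E * fst v + F * snd v)\<^sup>2 + (E * G - F\<^sup>2) * (snd v)\<^sup>2"
        by (simp add: q power2_eq_square algebra_simps)
      also have "\<dots> > 0"
      proof (cases "snd v = 0")
        case True
        then have "fst v \<noteq> 0" using v by (simp add: prod_eq_iff)
        then show ?thesis using True E by simp
      next
        case False
        then show ?thesis using D by (simp add: add_nonneg_pos)
      qed
      finally show "0 < induced_metric B X p v" using E by (simp add: zero_less_mult_iff)
    qed
  qed
qed

text \<open>The tangential coefficients solve a linear system whose matrix is the Gram matrix of the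
  two tangent vectors, and Cramer's rule gives the formula. The nonzero determinant yields existence
  and uniqueness of the projection even when the ambient form is indefinite.\<close>

lemma normal_part_eq:
  assumes sym: "\<And>u v. B u v = B v u" and lin: "\<And>v. linear (\<lambda>u. B u v)"
    and D: "metric_E B X p * metric_G B X p - (metric_F B X p)\<^sup>2 \<noteq> 0"
  defines "D \<equiv> metric_E B X p * metric_G B X p - (metric_F B X p)\<^sup>2"
  shows "normal_part B X p v = v
    - ((metric_G B X p * B v (partial_x X p) - metric_F B X p * B v (partial_y X p)) / D) *\<^sub>R partial_x X p
    - ((metric_E B X p * B v (partial_y X p) - metric_F B X p * B v (partial_x X p)) / D) *\<^sub>R partial_y X p"
    (is "_ = v - ?c *\<^sub>R _ - ?d *\<^sub>R _")
proof -
  define a b where "a = partial_x X p" and "b = partial_y X p"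
  define E F G where "E = metric_E B X p" and "F = metric_F B X p" and "G = metric_G B X p"
  define c d where "c = ?c" and "d = ?d"
  have BE: "B a a = E" "B a b = F" "B b a = F" "B b b = G"
    using sym[of b a] by (auto simp: E_def F_def G_def a_def b_def metric_E_def metric_F_def metric_G_def)
  have D0: "D \<noteq> 0" and D_eq: "D = E * G - F\<^sup>2" using D by (auto simp: D_def E_def F_def G_def)
  have c_eq: "c * D = G * B v a - F * B v b" and d_eq: "d * D = E * B v b - F * B v a"
    using D0 by (simp_all add: c_def d_def E_def F_def G_def a_def b_def)
  have Bl: "B (u + u') w = B u w + B u' w" "B (u - u') w = B u w - B u' w" "B (r *\<^sub>R u) w = r * B u w" for u u' w r
    using linear_add[OF lin[of w]] linear_diff[OF lin[of w]] linear_scale[OF lin[of w]] by auto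
  have Br: "B w (u + u') = B w u + B w u'" "B w (r *\<^sub>R u) = r * B w u" for u u' w r
    using Bl sym by metis+
  have span: "u \<in> span {a, b} \<longleftrightarrow> (\<exists>r t. u = r *\<^sub>R a + t *\<^sub>R b)" for u
    by (simp add: span_insert span_singleton image_iff) (metis add.commute add_diff_cancel_left' diff_add_cancel)
  have orth: "(\<forall>u\<in>span {a, b}. B w u = 0) \<longleftrightarrow> B w a = 0 \<and> B w b = 0" for w
    by (auto simp: span Br intro: span_base)
  show ?thesis
    unfolding c_def[symmetric] d_def[symmetric]
    unfolding normal_part_def a_def[symmetric] b_def[symmetric] orth
  proof (rule the_equality)
    have "D * (B v a - c * E - d * F) = D * B v a - (G * B v a - F * B v b) * E - (E * B v b - F * B v a) * F"
      "D * (B v b - c * F - d * G) = D * B v b - (G * B v a - F * B v b) * F - (E * B v b - F * B v a) * G"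
      unfolding c_eq[symmetric] d_eq[symmetric] by (simp_all add: algebra_simps)
    then have "D * (B v a - c * E - d * F) = 0" "D * (B v b - c * F - d * G) = 0"
      by (simp_all add: D_eq power2_eq_square algebra_simps)
    then have "B v a - c * E - d * F = 0" "B v b - c * F - d * G = 0" using D0 by auto
    moreover have "v - (v - c *\<^sub>R a - d *\<^sub>R b) = c *\<^sub>R a + d *\<^sub>R b" by simp
    ultimately show "v - (v - c *\<^sub>R a - d *\<^sub>R b) \<in> span {a, b} \<and>
        B (v - c *\<^sub>R a - d *\<^sub>R b) a = 0 \<and> B (v - c *\<^sub>R a - d *\<^sub>R b) b = 0"
      unfolding span by (simp only: Bl BE; blast)
  next
    fix w assume w: "v - w \<in> span {a, b} \<and> B w a = 0 \<and> B w b = 0"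
    then obtain r t where rt: "v - w = r *\<^sub>R a + t *\<^sub>R b" unfolding span by blast
    have "B v a = r * E + t * F" "B v b = r * F + t * G"
      using arg_cong[OF rt, of "\<lambda>u. B u a"] arg_cong[OF rt, of "\<lambda>u. B u b"] w by (simp_all add: Bl BE)
    then have "c * D = r * (E * G - F\<^sup>2)" "d * D = t * (E * G - F\<^sup>2)"
      unfolding c_eq d_eq by (simp_all add: power2_eq_square algebra_simps)
    then have "c = r" "d = t" using D0 D_eq by auto
    with rt show "w = v - c *\<^sub>R a - d *\<^sub>R b" by (simp add: algebra_simps)
  qed
qed

text \<open>The second derivatives of a graph map are vertical and the normal projection is linear,
  so the mean curvature vector is a positive multiple of the normal part of the vertical vector
  \<open>(0, 0, W)\<close>, with \<open>W\<close> the left-hand side of the graph equation. The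
  projection kills tangent vectors only, and no nonzero tangent vector of a graph is
  vertical.\<close>

lemma critical_graph_iff:
  fixes \<phi> :: "'n::finite height_map"
  assumes S: "open S" and \<phi>: "C2_on S \<phi>"
  shows "critical_graph s S \<phi> \<longleftrightarrow>
    (\<forall>p\<in>S. 0 < metric_E (signed_inner s) (graph_map \<phi>) p \<and>
      0 < metric_E (signed_inner s) (graph_map \<phi>) p * metric_G (signed_inner s) (graph_map \<phi>) p -
        (metric_F (signed_inner s) (graph_map \<phi>) p)\<^sup>2 \<and>
      metric_G (signed_inner s) (graph_map \<phi>) p *\<^sub>R partial_x (partial_x \<phi>) p
      - (2 * metric_F (signed_inner s) (graph_map \<phi>) p) *\<^sub>R partial_y (partial_x \<phi>) p
      + metric_E (signed_inner s) (graph_map \<phi>) p *\<^sub>R partial_y (partial_y \<phi>) p = 0)"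
proof -
  define B :: "real \<times> real \<times> (real ^ 'n) \<Rightarrow> _" where "B = signed_inner s"
  have sym: "B u v = B v u" for u v
    by (simp add: B_def signed_inner_def inner_commute mult.commute)
  have lin: "linear (\<lambda>u. B u v)" for v
    by (rule linearI) (simp_all add: B_def signed_inner_def inner_add_left algebra_simps)
  have "mean_curvature_vector B (graph_map \<phi>) p = 0 \<longleftrightarrow>
      metric_G B (graph_map \<phi>) p *\<^sub>R partial_x (partial_x \<phi>) p
      - (2 * metric_F B (graph_map \<phi>) p) *\<^sub>R partial_y (partial_x \<phi>) p
      + metric_E B (graph_map \<phi>) p *\<^sub>R partial_y (partial_y \<phi>) p = 0"
    if p: "p \<in> S" and D: "0 < metric_E B (graph_map \<phi>) p * metric_G B (graph_map \<phi>) p - (metric_F B (graph_map \<phi>) p)\<^sup>2"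
    for p
  proof -
    let ?X = "graph_map \<phi>"
    define E F G where "E = metric_E B ?X p" and "F = metric_F B ?X p" and "G = metric_G B ?X p"
    define N where "N = normal_part B ?X p"
    define a b where "a = partial_x ?X p" and "b = partial_y ?X p"
    define D' where "D' = E * G - F\<^sup>2"
    define c where "c = (\<lambda>v. (G * B v a - F * B v b) / D')"
    define d where "d = (\<lambda>v. (E * B v b - F * B v a) / D')"
    have D'0: "D' > 0" using D by (simp add: D'_def E_def F_def G_def)
    have N: "N v = v - c v *\<^sub>R a - d v *\<^sub>R b" for v
      using normal_part_eq[of B ?X p v, OF sym lin] D
      by (simp add: N_def c_def d_def a_def b_def D'_def E_def F_def G_def)
    have Blin: "B (u + u') w = B u w + B u' w" "B (r *\<^sub>R u) w = r * B u w" for u u' w r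
      using linear_add[OF lin[of w]] linear_scale[OF lin[of w]] by auto
    have N_lin: "linear N"
      by (rule linearI) (simp_all add: N c_def d_def Blin add_divide_distrib diff_divide_distrib algebra_simps)
    note px = partials_graph_map[OF S \<phi> p]
    define W where "W = G *\<^sub>R partial_x (partial_x \<phi>) p - (2 * F) *\<^sub>R partial_y (partial_x \<phi>) p
        + E *\<^sub>R partial_y (partial_y \<phi>) p"
    have "mean_curvature_vector B ?X p = (1 / (2 * D')) *\<^sub>R
        N (G *\<^sub>R partial_x (partial_x ?X) p - (2 * F) *\<^sub>R partial_y (partial_x ?X) p + E *\<^sub>R partial_y (partial_y ?X) p)"
      unfolding mean_curvature_vector_def linear_add[OF N_lin] linear_diff[OF N_lin] linear_scale[OF N_lin]
      by (simp add: N_def D'_def E_def F_def G_def)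
    also have "\<dots> = (1 / (2 * D')) *\<^sub>R N (0, 0, W)"
      by (simp add: px W_def)
    finally have "mean_curvature_vector B ?X p = 0 \<longleftrightarrow> N (0, 0, W) = 0"
      using D'0 by simp
    also have "\<dots> \<longleftrightarrow> W = 0"
    proof
      assume "N (0, 0, W) = 0"
      \<comment> \<open>The first two components of the tangent vectors \<open>a\<close> and
        \<open>b\<close> are (1, 0) and (0, 1); reading them off forces both coefficients to
        vanish.\<close>
      then have "(0, 0, W) = c (0, 0, W) *\<^sub>R a + d (0, 0, W) *\<^sub>R b"
        unfolding N by (simp add: algebra_simps)
      then have "c (0, 0, W) = 0 \<and> d (0, 0, W) = 0 \<and>
          W = c (0, 0, W) *\<^sub>R partial_x \<phi> p + d (0, 0, W) *\<^sub>R partial_y \<phi> p"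
        by (simp only: a_def b_def px scaleR_Pair add_Pair prod.inject) simp
      then show "W = 0" by (metis add_0 scaleR_zero_left)
    next
      assume "W = 0"
      then show "N (0, 0, W) = 0"
        using linear_0[OF N_lin] by (simp add: zero_prod_def)
    qed
    finally show ?thesis by (simp add: W_def E_def F_def G_def)
  qed
  then show ?thesis
    unfolding critical_graph_def spacelike_surface_def induced_metric_pos_iff B_def
    using C2_on_graph_map[OF S \<phi>] by blast
qed

section \<open>The Jacobian norm as a Gram determinant\<close>

lemma sum_pairs_less:
  fixes h :: "'n::{finite,linorder} \<Rightarrow> 'n \<Rightarrow> real"
  assumes "\<And>i j. h i j = h j i" "\<And>i. h i i = 0"
  shows "(\<Sum>i\<in>UNIV. \<Sum>j\<in>UNIV. h i j) = 2 * (\<Sum>(i, j)\<in>{(i, j). i < j}. h i j)"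
proof -
  have U: "UNIV \<times> UNIV = {(i, j). i < j} \<union> ({(i, j). j < i} \<union> {(i, j). i = (j::'n)})"
    by auto
  have "(\<Sum>i\<in>UNIV. \<Sum>j\<in>UNIV. h i j) = (\<Sum>(i, j)\<in>UNIV \<times> UNIV. h i j)"
    by (rule sum.cartesian_product)
  also have "\<dots> = (\<Sum>(i, j)\<in>{(i, j). i < j}. h i j) +
      ((\<Sum>(i, j)\<in>{(i, j). j < i}. h i j) + (\<Sum>(i, j)\<in>{(i, j). i = j}. h i j))"
    unfolding U by (subst sum.union_disjoint, simp, simp, force)+ simp
  also have "(\<Sum>(i, j)\<in>{(i, j). i = j}. h i j) = 0"
    by (rule sum.neutral) (auto simp: assms)
  also have "(\<Sum>(i, j)\<in>{(i, j). j < i}. h i j) = (\<Sum>(i, j)\<in>{(i, j). i < j}. h i j)"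
    by (rule sum.reindex_bij_witness[of _ prod.swap prod.swap]) (auto simp: assms)
  finally show ?thesis by simp
qed

text \<open>Over all ordered pairs the expanded square splits into products of single sums, which
  are inner products. Each unordered pair is counted twice there and the diagonal contributes
  nothing.\<close>

lemma lagrange_identity_less:
  fixes a b :: "real ^ 'n::{finite,linorder}"
  shows "(\<Sum>(i, j)\<in>{(i, j). i < j}. (a $ i * b $ j - b $ i * a $ j)\<^sup>2) = (a \<bullet> a) * (b \<bullet> b) - (a \<bullet> b)\<^sup>2"
proof -
  have "2 * (\<Sum>(i, j)\<in>{(i, j). i < j}. (a $ i * b $ j - b $ i * a $ j)\<^sup>2) =
      (\<Sum>i\<in>UNIV. \<Sum>j\<in>UNIV. (a $ i * b $ j - b $ i * a $ j)\<^sup>2)"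
    by (rule sum_pairs_less[symmetric]) (simp_all add: power2_eq_square algebra_simps)
  also have "\<dots> = (\<Sum>i\<in>UNIV. \<Sum>j\<in>UNIV. (a $ i * a $ i) * (b $ j * b $ j) + (b $ i * b $ i) * (a $ j * a $ j)
      - 2 * ((a $ i * b $ i) * (a $ j * b $ j)))"
    by (intro sum.cong refl) (simp add: power2_eq_square algebra_simps)
  also have "\<dots> = 2 * ((a \<bullet> a) * (b \<bullet> b) - (a \<bullet> b)\<^sup>2)"
    by (simp add: sum.distrib sum_subtractf sum_distrib_left[symmetric] sum_distrib_right[symmetric] inner_vec_def power2_eq_square)
  finally show ?thesis by simp
qed

lemma partial_vec_nth:
  fixes \<phi> :: "'n::finite height_map"
  assumes "has_partials S \<phi> a b" "p \<in> S"
  shows "partial_x (\<lambda>q. \<phi> q $ i) p = a p $ i" "partial_y (\<lambda>q. \<phi> q $ i) p = b p $ i"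
proof -
  have "((\<lambda>q. \<phi> q $ i) has_derivative (\<lambda>h. fst h *\<^sub>R a p $ i + snd h *\<^sub>R b p $ i)) (at p)"
    using bounded_linear.has_derivative[OF bounded_linear_vec_nth has_partialsD(1)[OF assms], of i] by simp
  then show "partial_x (\<lambda>q. \<phi> q $ i) p = a p $ i" "partial_y (\<lambda>q. \<phi> q $ i) p = b p $ i"
    by (rule partial_eqI)+
qed

lemma jacobian_norm_eq:
  fixes \<phi> :: "'n::{finite,linorder} height_map"
  assumes "has_partials S \<phi> a b" "p \<in> S"
  shows "jacobian_norm \<phi> p = sqrt ((a p \<bullet> a p) * (b p \<bullet> b p) - (a p \<bullet> b p)\<^sup>2)"
  by (simp add: jacobian_norm_def jacobian_det_def partial_vec_nth[OF assms] lagrange_identity_less)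

section \<open>Twin graphs\<close>

text \<open>For \<open>s = 1\<close> this is the first and for \<open>s = - 1\<close> the second form of the twin relations.\<close>

definition twin_at :: "real \<Rightarrow> 'n::finite height_map \<Rightarrow> 'n height_map \<Rightarrow> real \<times> real \<Rightarrow> bool" where
  "twin_at s \<phi> \<psi> p \<longleftrightarrow>
    (let E = metric_E (signed_inner s) (graph_map \<phi>) p; F = metric_F (signed_inner s) (graph_map \<phi>) p;
         G = metric_G (signed_inner s) (graph_map \<phi>) p; w = area_element (signed_inner s) (graph_map \<phi>) p
     in partial_x \<psi> p = s *\<^sub>R ((F / w) *\<^sub>R partial_x \<phi> p - (E / w) *\<^sub>R partial_y \<phi> p) \<and>
        partial_y \<psi> p = s *\<^sub>R ((G / w) *\<^sub>R partial_x \<phi> p - (F / w) *\<^sub>R partial_y \<phi> p))"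

text \<open>The twin relations apply to the pair (a, b) the matrix with rows (F, -E) and (G, -F),
  scaled by s / sqrt D. Its determinant is 1, so the 2 by 2 minors are preserved. Its trace is 0, so
  by Cayley-Hamilton its square is -1, which gives the last two equations. The first three compute
  the metric of the twin, where the height part carries the opposite sign.\<close>

lemma twin_metric_algebra:
  fixes a b :: "real ^ 'n" and s :: real
  assumes s: "s * s = 1"
  defines "E \<equiv> 1 + s * (a \<bullet> a)" and "F \<equiv> s * (a \<bullet> b)" and "G \<equiv> 1 + s * (b \<bullet> b)"
  defines "D \<equiv> E * G - F\<^sup>2" and "J \<equiv> (a \<bullet> a) * (b \<bullet> b) - (a \<bullet> b)\<^sup>2"
  assumes D: "0 < D"
  assumes a': "a' = s *\<^sub>R ((F / sqrt D) *\<^sub>R a - (E / sqrt D) *\<^sub>R b)"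
    and b': "b' = s *\<^sub>R ((G / sqrt D) *\<^sub>R a - (F / sqrt D) *\<^sub>R b)"
  shows "1 - s * (a' \<bullet> a') = (1 - J) / D * E" "- s * (a' \<bullet> b') = (1 - J) / D * F"
    "1 - s * (b' \<bullet> b') = (1 - J) / D * G"
    "a' $ i * b' $ j - b' $ i * a' $ j = a $ i * b $ j - b $ i * a $ j"
    "(F / sqrt D) *\<^sub>R a' - (E / sqrt D) *\<^sub>R b' = - s *\<^sub>R a"
    "(G / sqrt D) *\<^sub>R a' - (F / sqrt D) *\<^sub>R b' = - s *\<^sub>R b"
proof -
  define r where "r = inverse (sqrt D)"
  have r2: "r * r = inverse D" using D by (simp add: r_def inverse_mult_distrib[symmetric] del: inverse_mult_distrib)
  have r2D: "r * r * D = 1" using D by (simp add: r2)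
  have a'': "a' = (s * r) *\<^sub>R (F *\<^sub>R a - E *\<^sub>R b)" and b'': "b' = (s * r) *\<^sub>R (G *\<^sub>R a - F *\<^sub>R b)"
    by (simp_all add: a' b' r_def divide_inverse scaleR_diff_right mult_ac)
  \<comment> \<open>Expanding D gives 1 + s (a.a + b.b) + s^2 J. Since s^2 = 1, the Jacobian term is
    the same for both signs, and 1 - J becomes a polynomial in E, F, G.\<close>
  have J: "1 - J = E + G - D"
  proof -
    have "1 - J = 1 - (s * s) * J" by (simp add: s)
    also have "\<dots> = E + G - D"
      by (simp add: J_def D_def E_def F_def G_def power2_eq_square algebra_simps)
    finally show ?thesis .
  qed
  have sab: "s * (a \<bullet> a) = E - 1" "s * (a \<bullet> b) = F" "s * (b \<bullet> b) = G - 1"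
    by (simp_all add: E_def F_def G_def)
  \<comment> \<open>One formula for all three Gram entries of the twin, written in E, F, G alone so
    that the metric identities become polynomial.\<close>
  have quad: "s * ((s * r) *\<^sub>R (x *\<^sub>R a - y *\<^sub>R b) \<bullet> (s * r) *\<^sub>R (z *\<^sub>R a - w *\<^sub>R b)) =
      inverse D * (x * z * (E - 1) - (x * w + y * z) * F + y * w * (G - 1))" for x y z w
  proof -
    have "s * ((s * r) *\<^sub>R (x *\<^sub>R a - y *\<^sub>R b) \<bullet> (s * r) *\<^sub>R (z *\<^sub>R a - w *\<^sub>R b)) =
        (s * s) * (r * r) * (x * z * (s * (a \<bullet> a)) - (x * w + y * z) * (s * (a \<bullet> b)) + y * w * (s * (b \<bullet> b)))"
      by (simp add: inner_diff_left inner_diff_right inner_commute[of b a] algebra_simps)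
    then show ?thesis unfolding s r2 sab by simp
  qed
  show "1 - s * (a' \<bullet> a') = (1 - J) / D * E" "- s * (a' \<bullet> b') = (1 - J) / D * F"
    "1 - s * (b' \<bullet> b') = (1 - J) / D * G"
    unfolding a'' b'' J mult_minus_left quad using D
    by (simp_all add: field_simps) (simp_all add: D_def power2_eq_square algebra_simps)
  have "a' $ i * b' $ j - b' $ i * a' $ j = (s * s) * (r * r * D) * (a $ i * b $ j - b $ i * a $ j)"
    by (simp add: a'' b'' D_def power2_eq_square algebra_simps)
  then show "a' $ i * b' $ j - b' $ i * a' $ j = a $ i * b $ j - b $ i * a $ j"
    by (simp add: s r2D)
  have "(F / sqrt D) *\<^sub>R a' - (E / sqrt D) *\<^sub>R b' = (- s * (r * r * D)) *\<^sub>R a"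
    "(G / sqrt D) *\<^sub>R a' - (F / sqrt D) *\<^sub>R b' = (- s * (r * r * D)) *\<^sub>R b"
    unfolding divide_inverse r_def[symmetric]
    by (simp_all add: vec_eq_iff a'' b'' D_def power2_eq_square algebra_simps)
  then show "(F / sqrt D) *\<^sub>R a' - (E / sqrt D) *\<^sub>R b' = - s *\<^sub>R a"
    "(G / sqrt D) *\<^sub>R a' - (F / sqrt D) *\<^sub>R b' = - s *\<^sub>R b"
    by (simp_all add: r2D)
qed

text \<open>All conclusions come from one conformal factor c: the metric scales by c, hence so does
  the area element, and w' w = c w^2 = 1 - ||J||^2. The quotients E / w, F / w, G / w do not change,
  so the reversed relation is the same matrix applied once more.\<close>

lemma twin_at_imp:
  fixes \<phi> \<psi> :: "'n::{finite,linorder} height_map"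
  assumes S: "open S" and \<phi>: "C2_on S \<phi>" and \<psi>: "C2_on S \<psi>" and p: "p \<in> S" and s: "s * s = 1"
    and D: "0 < metric_E (signed_inner s) (graph_map \<phi>) p * metric_G (signed_inner s) (graph_map \<phi>) p -
        (metric_F (signed_inner s) (graph_map \<phi>) p)\<^sup>2"
    and J: "jacobian_norm \<phi> p < 1" and twin: "twin_at s \<phi> \<psi> p"
  defines "w \<equiv> area_element (signed_inner s) (graph_map \<phi>) p"
    and "w' \<equiv> area_element (signed_inner (- s)) (graph_map \<psi>) p"
  shows "0 < w" "0 < w'" "w' * w = 1 - (jacobian_norm \<phi> p)\<^sup>2"
    "metric_E (signed_inner (- s)) (graph_map \<psi>) p = w' / w * metric_E (signed_inner s) (graph_map \<phi>) p"
    "metric_F (signed_inner (- s)) (graph_map \<psi>) p = w' / w * metric_F (signed_inner s) (graph_map \<phi>) p"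
    "metric_G (signed_inner (- s)) (graph_map \<psi>) p = w' / w * metric_G (signed_inner s) (graph_map \<phi>) p"
    "jacobian_det \<psi> i j p = jacobian_det \<phi> i j p"
    "jacobian_norm \<psi> p = jacobian_norm \<phi> p"
    "twin_at (- s) \<psi> \<phi> p"
proof -
  define a b where "a = partial_x \<phi> p" and "b = partial_y \<phi> p"
  define a' b' where "a' = partial_x \<psi> p" and "b' = partial_y \<psi> p"
  define E F G where "E = 1 + s * (a \<bullet> a)" and "F = s * (a \<bullet> b)" and "G = 1 + s * (b \<bullet> b)"
  define D' where "D' = E * G - F\<^sup>2"
  define J2 where "J2 = (a \<bullet> a) * (b \<bullet> b) - (a \<bullet> b)\<^sup>2"
  note m = metric_graph_map[OF S \<phi> p, of s, folded a_def b_def, folded E_def F_def G_def]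
  note m' = metric_graph_map[OF S \<psi> p, of "- s", folded a'_def b'_def]
  have D0: "D' > 0" using D by (simp add: m D'_def)
  have w: "w = sqrt D'" by (simp add: w_def area_element_def m D'_def)
  then show w0: "0 < w" using D0 by simp
  have tw: "a' = s *\<^sub>R ((F / sqrt D') *\<^sub>R a - (E / sqrt D') *\<^sub>R b)"
    "b' = s *\<^sub>R ((G / sqrt D') *\<^sub>R a - (F / sqrt D') *\<^sub>R b)"
    using twin unfolding twin_at_def Let_def m a_def[symmetric] b_def[symmetric] a'_def[symmetric] b'_def[symmetric]
      w_def[symmetric] w by auto
  note alg = twin_metric_algebra[OF s, of a b, folded E_def F_def G_def, folded D'_def J2_def, OF D0 tw]
  have J2_nonneg: "0 \<le> J2"
    using Cauchy_Schwarz_ineq[of a b] by (simp add: J2_def)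
  have Jn: "jacobian_norm \<phi> p = sqrt J2"
    using jacobian_norm_eq[OF C2_on_imp_has_partials(1)[OF S \<phi>] p] by (simp add: J2_def a_def b_def)
  have J2: "J2 < 1" "(jacobian_norm \<phi> p)\<^sup>2 = J2"
    using J J2_nonneg by (simp_all add: Jn)
  \<comment> \<open>The conformal factor; the bound on the Jacobian norm is what makes it
    positive.\<close>
  define c where "c = (1 - J2) / D'"
  have c0: "c > 0" using J2 D0 by (simp add: c_def)
  have E': "metric_E (signed_inner (- s)) (graph_map \<psi>) p = c * E"
    and F': "metric_F (signed_inner (- s)) (graph_map \<psi>) p = c * F"
    and G': "metric_G (signed_inner (- s)) (graph_map \<psi>) p = c * G"
    using alg(1-3) by (simp_all add: m' c_def)
  have "w' = sqrt (c\<^sup>2 * D')"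
    unfolding w'_def area_element_def E' F' G' by (simp add: D'_def power2_eq_square algebra_simps)
  also have "\<dots> = c * w"
    using c0 by (simp add: real_sqrt_mult w)
  finally have w': "w' = c * w" .
  then show "0 < w'" using c0 w0 by simp
  have ww: "w * w = D'" using D0 by (simp add: w)
  then show "w' * w = 1 - (jacobian_norm \<phi> p)\<^sup>2"
    using D0 by (simp add: w' J2(2) c_def mult.assoc)
  have c: "w' / w = c" using w0 by (simp add: w')
  then show "metric_E (signed_inner (- s)) (graph_map \<psi>) p = w' / w * metric_E (signed_inner s) (graph_map \<phi>) p"
    "metric_F (signed_inner (- s)) (graph_map \<psi>) p = w' / w * metric_F (signed_inner s) (graph_map \<phi>) p"
    "metric_G (signed_inner (- s)) (graph_map \<psi>) p = w' / w * metric_G (signed_inner s) (graph_map \<phi>) p"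
    by (simp_all add: E' F' G' m)
  show jac: "jacobian_det \<psi> i j p = jacobian_det \<phi> i j p" for i j
    using alg(4)[of i j]
    by (simp add: jacobian_det_def partial_vec_nth[OF C2_on_imp_has_partials(1)[OF S \<phi>] p]
        partial_vec_nth[OF C2_on_imp_has_partials(1)[OF S \<psi>] p] a_def b_def a'_def b'_def)
  show "jacobian_norm \<psi> p = jacobian_norm \<phi> p"
    by (simp add: jacobian_norm_def jac)
  \<comment> \<open>The coefficients of the twin relations are conformally invariant.\<close>
  have "c * E / w' = E / sqrt D'" "c * F / w' = F / sqrt D'" "c * G / w' = G / sqrt D'"
    using c0 by (simp_all add: w' w)
  then show "twin_at (- s) \<psi> \<phi> p"
    unfolding twin_at_def Let_def E' F' G' w'_def[symmetric] a_def[symmetric] b_def[symmetric]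
      a'_def[symmetric] b'_def[symmetric]
    using alg(5,6) s by simp
qed

section \<open>Harmonicity of the coordinates and construction of the twin\<close>

text \<open>The repeated functions \<open>\<mu>\<close> and \<open>\<nu>\<close> express that the two coordinate functions of the domain
  are harmonic on the graph.\<close>

lemma area_element_ratio_partials:
  fixes \<phi> :: "'n::finite height_map"
  assumes S: "open S" and \<phi>: "C2_on S \<phi>" and crit: "critical_graph s S \<phi>"
  obtains \<alpha>x \<mu> \<nu> \<gamma>y where
    "has_partials S (\<lambda>p. metric_E (signed_inner s) (graph_map \<phi>) p / area_element (signed_inner s) (graph_map \<phi>) p) \<alpha>x \<mu>"
    "has_partials S (\<lambda>p. metric_F (signed_inner s) (graph_map \<phi>) p / area_element (signed_inner s) (graph_map \<phi>) p) \<mu> \<nu>"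
    "has_partials S (\<lambda>p. metric_G (signed_inner s) (graph_map \<phi>) p / area_element (signed_inner s) (graph_map \<phi>) p) \<nu> \<gamma>y"
proof -
  define a b where "a = partial_x \<phi>" and "b = partial_y \<phi>"
  define k m q where "k = partial_x a" and "m = partial_y a" and "q = partial_y b"
  note h = C2_on_imp_has_partials(2,3)[OF S \<phi>, folded a_def b_def, folded k_def m_def q_def]
  define E F G where "E = (\<lambda>p. 1 + s * (a p \<bullet> a p))" and "F = (\<lambda>p. s * (a p \<bullet> b p))"
    and "G = (\<lambda>p. 1 + s * (b p \<bullet> b p))"
  define D where "D = (\<lambda>p. E p * G p - F p * F p)"
  define r where "r = (\<lambda>p. inverse (sqrt (D p)))"
  note me = metric_graph_map[OF S \<phi>, of _ s, folded a_def b_def, folded E_def F_def G_def]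
  have D0: "0 < D p" and eq: "G p *\<^sub>R k p - (2 * F p) *\<^sub>R m p + E p *\<^sub>R q p = 0" if "p \<in> S" for p
    using crit that unfolding critical_graph_iff[OF S \<phi>]
    by (auto simp: me D_def E_def F_def G_def a_def b_def k_def m_def q_def power2_eq_square)
  note c1 = has_partials_const[of S "1 :: real"] and cs = has_partials_const[of S s]
  have E: "has_partials S E (\<lambda>p. 2 * s * (a p \<bullet> k p)) (\<lambda>p. 2 * s * (a p \<bullet> m p))"
    by (rule has_partials_cong[OF has_partials_add[OF c1 has_partials_mult[OF cs has_partials_inner[OF h(1) h(1)]]] S])
      (simp_all add: E_def inner_commute algebra_simps)
  have F: "has_partials S F (\<lambda>p. s * (a p \<bullet> m p + k p \<bullet> b p)) (\<lambda>p. s * (a p \<bullet> q p + m p \<bullet> b p))"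
    by (rule has_partials_cong[OF has_partials_mult[OF cs has_partials_inner[OF h(1) h(2)]] S])
      (simp_all add: F_def)
  have G: "has_partials S G (\<lambda>p. 2 * s * (b p \<bullet> m p)) (\<lambda>p. 2 * s * (b p \<bullet> q p))"
    by (rule has_partials_cong[OF has_partials_add[OF c1 has_partials_mult[OF cs has_partials_inner[OF h(2) h(2)]]] S])
      (simp_all add: G_def inner_commute algebra_simps)
  \<comment> \<open>Half the x-derivative of D; the 2 cancels against the 1/2 from differentiating
    the inverse square root.\<close>
  define Dx where "Dx = (\<lambda>p. s * (E p * (b p \<bullet> m p) + G p * (a p \<bullet> k p) - F p * (a p \<bullet> m p + k p \<bullet> b p)))"
  define Dy where "Dy = (\<lambda>p. s * (E p * (b p \<bullet> q p) + G p * (a p \<bullet> m p) - F p * (a p \<bullet> q p + m p \<bullet> b p)))"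
  have D: "has_partials S D (\<lambda>p. 2 * Dx p) (\<lambda>p. 2 * Dy p)"
    by (rule has_partials_cong[OF has_partials_diff[OF has_partials_mult[OF E G] has_partials_mult[OF F F]] S])
      (simp_all add: D_def Dx_def Dy_def algebra_simps)
  have "has_partials S r (\<lambda>p. (- (r p ^ 3) / 2) * (2 * Dx p)) (\<lambda>p. (- (r p ^ 3) / 2) * (2 * Dy p))"
    unfolding r_def
  proof (rule has_partials_real_compose[OF D])
    fix p assume p: "p \<in> S"
    show "((\<lambda>t. inverse (sqrt t)) has_real_derivative - (inverse (sqrt (D p)) ^ 3) / 2) (at (D p))"
      using D0[OF p] by (auto intro!: derivative_eq_intros simp: field_simps power3_eq_cube)
  next
    have "sqrt (D p) \<noteq> 0" if "p \<in> S" for p using D0[OF that] by simp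
    then show "continuous_on S (\<lambda>p. - (inverse (sqrt (D p)) ^ 3) / 2)"
      by (intro continuous_intros has_partialsD(4)[OF D]) auto
  qed
  then have r: "has_partials S r (\<lambda>p. - (r p ^ 3) * Dx p) (\<lambda>p. - (r p ^ 3) * Dy p)"
    by simp
  have r2: "r p * r p * D p = 1" if "p \<in> S" for p
    using D0[OF that] by (simp add: r_def inverse_mult_distrib[symmetric] del: inverse_mult_distrib)
  have rel: "G p * (k p \<bullet> v) - 2 * F p * (m p \<bullet> v) + E p * (q p \<bullet> v) = 0" if "p \<in> S" for p v
    using arg_cong[OF eq[OF that], of "\<lambda>u. u \<bullet> v"] by (simp add: inner_add_left inner_diff_left)
  \<comment> \<open>With r^2 D = 1 the factor r^3 comes out of every quotient-rule expression, and
    what remains to be compared is polynomial.\<close>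
  have red: "u * (- (r p ^ 3) * d) + v * r p = r p ^ 3 * (v * D p - u * d)" if "p \<in> S" for p u v d
  proof -
    have "v * r p = v * r p * (r p * r p * D p)" by (simp add: r2[OF that])
    then show ?thesis by (simp add: power3_eq_cube algebra_simps)
  qed
  note xE = has_partials_mult[OF E r] and xF = has_partials_mult[OF F r] and xG = has_partials_mult[OF G r]
  have 1: "E p * (- (r p ^ 3) * Dy p) + 2 * s * (a p \<bullet> m p) * r p =
      F p * (- (r p ^ 3) * Dx p) + s * (a p \<bullet> m p + k p \<bullet> b p) * r p" if p: "p \<in> S" for p
  proof -
    \<comment> \<open>Up to the factor r^3, the defect of \<alpha>_y = \<beta>_x is the graph
      equation paired with s (F a - E b), a multiple of the x-derivative prescribed for the
      twin.\<close>
    have "(2 * s * (a p \<bullet> m p) * D p - E p * Dy p) - (s * (a p \<bullet> m p + k p \<bullet> b p) * D p - F p * Dx p)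
      = s * F p * (G p * (k p \<bullet> a p) - 2 * F p * (m p \<bullet> a p) + E p * (q p \<bullet> a p))
        - s * E p * (G p * (k p \<bullet> b p) - 2 * F p * (m p \<bullet> b p) + E p * (q p \<bullet> b p))"
      by (simp add: Dx_def Dy_def D_def inner_commute algebra_simps)
    then show ?thesis unfolding red[OF p] by (simp add: rel[OF p])
  qed
  have 2: "G p * (- (r p ^ 3) * Dx p) + 2 * s * (b p \<bullet> m p) * r p =
      F p * (- (r p ^ 3) * Dy p) + s * (a p \<bullet> q p + m p \<bullet> b p) * r p" if p: "p \<in> S" for p
  proof -
    \<comment> \<open>Likewise the defect of \<gamma>_x = \<beta>_y is the graph equation paired
      with - s (G a - F b), a multiple of the prescribed y-derivative.\<close>
    have "(2 * s * (b p \<bullet> m p) * D p - G p * Dx p) - (s * (a p \<bullet> q p + m p \<bullet> b p) * D p - F p * Dy p)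
      = s * F p * (G p * (k p \<bullet> b p) - 2 * F p * (m p \<bullet> b p) + E p * (q p \<bullet> b p))
        - s * G p * (G p * (k p \<bullet> a p) - 2 * F p * (m p \<bullet> a p) + E p * (q p \<bullet> a p))"
      by (simp add: Dx_def Dy_def D_def inner_commute algebra_simps)
    then show ?thesis unfolding red[OF p] by (simp add: rel[OF p])
  qed
  have quot: "metric_E (signed_inner s) (graph_map \<phi>) p / area_element (signed_inner s) (graph_map \<phi>) p = E p * r p"
    "metric_F (signed_inner s) (graph_map \<phi>) p / area_element (signed_inner s) (graph_map \<phi>) p = F p * r p"
    "metric_G (signed_inner s) (graph_map \<phi>) p / area_element (signed_inner s) (graph_map \<phi>) p = G p * r p"
    if "p \<in> S" for p
    by (simp_all add: area_element_def me[OF that] E_def F_def G_def D_def r_def divide_inverse power2_eq_square)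
  \<comment> \<open>\<mu> and \<nu> are taken to be the y-partials of \<alpha> and \<beta>; facts
    \<open>1\<close> and \<open>2\<close> identify them with the x-partials of \<beta> and
    \<gamma>.\<close>
  show ?thesis
    by (rule that[OF has_partials_cong[OF xE S quot(1) refl refl] has_partials_cong[OF xF S quot(2) 1 refl]
          has_partials_cong[OF xG S quot(3) 2[symmetric] refl]])
qed

lemma exists_twin:
  fixes \<phi> :: "'n::{finite,linorder} height_map"
  assumes S: "open S" "simply_connected S" and \<phi>: "C2_on S \<phi>" and crit: "critical_graph s S \<phi>"
    and s: "s * s = 1" and J: "\<And>p. p \<in> S \<Longrightarrow> jacobian_norm \<phi> p < 1"
  obtains \<psi> :: "'n height_map" where "C2_on S \<psi>" "critical_graph (- s) S \<psi>"
    "\<And>p. p \<in> S \<Longrightarrow> twin_at s \<phi> \<psi> p"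
proof -
  define a b where "a = partial_x \<phi>" and "b = partial_y \<phi>"
  define k m q where "k = partial_x a" and "m = partial_y a" and "q = partial_y b"
  note h = C2_on_imp_has_partials(2,3)[OF S(1) \<phi>, folded a_def b_def, folded k_def m_def q_def]
  define E F G w where "E = metric_E (signed_inner s) (graph_map \<phi>)"
    and "F = metric_F (signed_inner s) (graph_map \<phi>)" and "G = metric_G (signed_inner s) (graph_map \<phi>)"
    and "w = area_element (signed_inner s) (graph_map \<phi>)"
  define \<alpha> \<beta> \<gamma> where "\<alpha> = (\<lambda>p. E p / w p)" and "\<beta> = (\<lambda>p. F p / w p)" and "\<gamma> = (\<lambda>p. G p / w p)"
  have E0: "0 < E p" and D0: "0 < E p * G p - (F p)\<^sup>2"
    and eq: "G p *\<^sub>R k p - (2 * F p) *\<^sub>R m p + E p *\<^sub>R q p = 0" if "p \<in> S" for p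
    using crit that unfolding critical_graph_iff[OF S(1) \<phi>]
    by (auto simp: E_def F_def G_def a_def b_def k_def m_def q_def)
  have w: "0 < w p" "w p * w p = E p * G p - (F p)\<^sup>2" if "p \<in> S" for p
    using D0[OF that] by (simp_all add: w_def area_element_def E_def F_def G_def)
  have EFG: "E p = w p * \<alpha> p" "F p = w p * \<beta> p" "G p = w p * \<gamma> p" if "p \<in> S" for p
    using w(1)[OF that] by (simp_all add: \<alpha>_def \<beta>_def \<gamma>_def)
  obtain \<alpha>x \<mu> \<nu> \<gamma>y where \<alpha>: "has_partials S \<alpha> \<alpha>x \<mu>" and \<beta>: "has_partials S \<beta> \<mu> \<nu>"
    and \<gamma>: "has_partials S \<gamma> \<nu> \<gamma>y"
    using area_element_ratio_partials[OF S(1) \<phi> crit, folded E_def F_def G_def w_def, folded \<alpha>_def \<beta>_def \<gamma>_def] .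
  have det: "\<alpha> p * \<gamma> p - \<beta> p * \<beta> p = 1" if "p \<in> S" for p
  proof -
    have "w p * w p * (\<alpha> p * \<gamma> p - \<beta> p * \<beta> p) = w p * w p * 1"
      using w(2)[OF that] by (simp add: EFG[OF that] power2_eq_square algebra_simps)
    then show ?thesis using w(1)[OF that] by simp
  qed
  \<comment> \<open>The x- and y-derivatives of the determinant identity, with the shared partials
    \<mu> and \<nu> inserted.\<close>
  have ddet: "\<alpha> p * \<nu> p + \<alpha>x p * \<gamma> p = 2 * \<beta> p * \<mu> p" "\<alpha> p * \<gamma>y p + \<mu> p * \<gamma> p = 2 * \<beta> p * \<nu> p"
    if p: "p \<in> S" for p
  proof -
    note dd = has_partials_diff[OF has_partials_mult[OF \<alpha> \<gamma>] has_partials_mult[OF \<beta> \<beta>]]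
    have "has_partials S (\<lambda>p. \<alpha> p * \<gamma> p - \<beta> p * \<beta> p) (\<lambda>_. 0) (\<lambda>_. 0)"
      by (rule has_partials_cong[OF has_partials_const[of S 1] S(1)]) (simp_all add: det)
    from has_partials_imp_partial_eq[OF this p] has_partials_imp_partial_eq[OF dd p]
    show "\<alpha> p * \<nu> p + \<alpha>x p * \<gamma> p = 2 * \<beta> p * \<mu> p" "\<alpha> p * \<gamma>y p + \<mu> p * \<gamma> p = 2 * \<beta> p * \<nu> p"
      by simp_all
  qed
  define a' where "a' = (\<lambda>p. s *\<^sub>R (\<beta> p *\<^sub>R a p - \<alpha> p *\<^sub>R b p))"
  define b' where "b' = (\<lambda>p. s *\<^sub>R (\<gamma> p *\<^sub>R a p - \<beta> p *\<^sub>R b p))"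
  \<comment> \<open>The product rule gives partials \<open>k'\<close>, \<open>m'\<close> of
    \<open>a'\<close> and \<open>n'\<close>, \<open>q'\<close> of \<open>b'\<close>; closedness of
    the prescribed differential is \<open>m' = n'\<close>.\<close>
  define k' where "k' = (\<lambda>p. s *\<^sub>R ((\<beta> p *\<^sub>R k p + \<mu> p *\<^sub>R a p) - (\<alpha> p *\<^sub>R m p + \<alpha>x p *\<^sub>R b p)))"
  define m' where "m' = (\<lambda>p. s *\<^sub>R ((\<beta> p *\<^sub>R m p + \<nu> p *\<^sub>R a p) - (\<alpha> p *\<^sub>R q p + \<mu> p *\<^sub>R b p)))"
  define n' where "n' = (\<lambda>p. s *\<^sub>R ((\<gamma> p *\<^sub>R k p + \<nu> p *\<^sub>R a p) - (\<beta> p *\<^sub>R m p + \<mu> p *\<^sub>R b p)))"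
  define q' where "q' = (\<lambda>p. s *\<^sub>R ((\<gamma> p *\<^sub>R m p + \<gamma>y p *\<^sub>R a p) - (\<beta> p *\<^sub>R q p + \<nu> p *\<^sub>R b p)))"
  note cs = has_partials_const[of S s]
  have a': "has_partials S a' k' m'"
    by (rule has_partials_cong[OF has_partials_scaleR[OF cs has_partials_diff
            [OF has_partials_scaleR[OF \<beta> h(1)] has_partials_scaleR[OF \<alpha> h(2)]]] S(1)])
      (simp_all add: a'_def k'_def m'_def)
  have "m' p = n' p" if p: "p \<in> S" for p
  proof -
    have "w p *\<^sub>R (\<gamma> p *\<^sub>R k p - (2 * \<beta> p) *\<^sub>R m p + \<alpha> p *\<^sub>R q p) = 0"
      using eq[OF p] by (simp add: EFG[OF p] scaleR_add_right scaleR_diff_right mult_ac)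
    then have "\<gamma> p *\<^sub>R k p - (2 * \<beta> p) *\<^sub>R m p + \<alpha> p *\<^sub>R q p = 0" using w(1)[OF p] by simp
    \<comment> \<open>The terms with \<mu> and \<nu> cancel thanks to harmonicity of the
      coordinates, and the rest is the graph equation divided by w.\<close>
    moreover have "n' p - m' p = s *\<^sub>R (\<gamma> p *\<^sub>R k p - (2 * \<beta> p) *\<^sub>R m p + \<alpha> p *\<^sub>R q p)"
      by (simp add: vec_eq_iff n'_def m'_def algebra_simps)
    ultimately show ?thesis by simp
  qed
  note mn = this
  have b': "has_partials S b' m' q'"
    by (rule has_partials_cong[OF has_partials_scaleR[OF cs has_partials_diff
            [OF has_partials_scaleR[OF \<gamma> h(1)] has_partials_scaleR[OF \<beta> h(2)]]] S(1)])
      (simp_all add: b'_def n'_def q'_def mn)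
  obtain \<psi> where \<psi>: "has_partials S \<psi> a' b'"
    using exists_potential[OF S a' b'] .
  have C2: "C2_on S \<psi>" using \<psi> a' b' by (rule has_partials_imp_C2_on)
  note p1 = has_partials_imp_partial_eq[OF \<psi>]
  have "has_partials S (partial_x \<psi>) k' m'" "has_partials S (partial_y \<psi>) m' q'"
    by (rule has_partials_cong[OF a' S(1)] has_partials_cong[OF b' S(1)]; simp add: p1)+
  note p2 = has_partials_imp_partial_eq[OF this(1)] has_partials_imp_partial_eq[OF this(2)]
  have twin: "twin_at s \<phi> \<psi> p" if "p \<in> S" for p
    by (simp add: twin_at_def Let_def p1 that a'_def b'_def \<alpha>_def \<beta>_def \<gamma>_def E_def F_def G_def w_def a_def b_def)
  have "critical_graph (- s) S \<psi>"
    unfolding critical_graph_iff[OF S(1) C2]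
  proof (intro ballI conjI)
    fix p assume p: "p \<in> S"
    note tw = twin_at_imp[OF S(1) \<phi> C2 p s D0[OF p, unfolded E_def F_def G_def] J[OF p] twin[OF p],
        folded E_def F_def G_def w_def]
    define w' where "w' = area_element (signed_inner (- s)) (graph_map \<psi>) p"
    have w': "0 < w'" using tw(2) by (simp add: w'_def)
    note m = tw(4-6)[folded w'_def]
    show "0 < metric_E (signed_inner (- s)) (graph_map \<psi>) p"
      using w' w(1)[OF p] E0[OF p] by (simp add: m)
    have "metric_E (signed_inner (- s)) (graph_map \<psi>) p * metric_G (signed_inner (- s)) (graph_map \<psi>) p -
        (metric_F (signed_inner (- s)) (graph_map \<psi>) p)\<^sup>2 = (w' / w p)\<^sup>2 * (E p * G p - (F p)\<^sup>2)"
      unfolding m power2_eq_square by (simp add: algebra_simps)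
    then show "0 < metric_E (signed_inner (- s)) (graph_map \<psi>) p * metric_G (signed_inner (- s)) (graph_map \<psi>) p -
        (metric_F (signed_inner (- s)) (graph_map \<psi>) p)\<^sup>2"
      using w' w(1)[OF p] D0[OF p] by simp
    \<comment> \<open>The middle term is shared evenly between the equal mixed derivatives
      \<open>m'\<close> and \<open>n'\<close>. In this form the second derivatives of \<phi> cancel
      identically, and the coefficients of \<open>a\<close> and \<open>b\<close> that remain are the
      two equations in \<open>ddet\<close>.\<close>
    have "metric_G (signed_inner (- s)) (graph_map \<psi>) p *\<^sub>R partial_x (partial_x \<psi>) p
      - (2 * metric_F (signed_inner (- s)) (graph_map \<psi>) p) *\<^sub>R partial_y (partial_x \<psi>) p
      + metric_E (signed_inner (- s)) (graph_map \<psi>) p *\<^sub>R partial_y (partial_y \<psi>) p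
      = w' *\<^sub>R (\<gamma> p *\<^sub>R k' p - \<beta> p *\<^sub>R m' p - \<beta> p *\<^sub>R n' p + \<alpha> p *\<^sub>R q' p)"
      using w(1)[OF p] unfolding m p2[OF p] EFG[OF p] mn[OF p]
      by (simp add: vec_eq_iff algebra_simps)
    also have "\<gamma> p *\<^sub>R k' p - \<beta> p *\<^sub>R m' p - \<beta> p *\<^sub>R n' p + \<alpha> p *\<^sub>R q' p =
        s *\<^sub>R ((\<alpha> p * \<gamma>y p + \<mu> p * \<gamma> p - 2 * \<beta> p * \<nu> p) *\<^sub>R a p
          - (\<alpha> p * \<nu> p + \<alpha>x p * \<gamma> p - 2 * \<beta> p * \<mu> p) *\<^sub>R b p)"
      by (simp add: vec_eq_iff k'_def m'_def n'_def q'_def algebra_simps)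
    also have "\<dots> = 0" by (simp add: ddet[OF p])
    finally show "metric_G (signed_inner (- s)) (graph_map \<psi>) p *\<^sub>R partial_x (partial_x \<psi>) p
      - (2 * metric_F (signed_inner (- s)) (graph_map \<psi>) p) *\<^sub>R partial_y (partial_x \<psi>) p
      + metric_E (signed_inner (- s)) (graph_map \<psi>) p *\<^sub>R partial_y (partial_y \<psi>) p = 0"
      by simp
  qed
  with that C2 twin show ?thesis by blast
qed

section \<open>Passage to the two stated forms of the twin relations\<close>

lemma twin_to_maximal_iff:
  fixes f g :: "'n::finite height_map"
  assumes "open S" "C2_on S f" "C2_on S g" "p \<in> S"
  shows "twin_to_maximal f g p \<longleftrightarrow> twin_at 1 f g p"
  unfolding twin_to_maximal_def twin_at_def Let_def vec_eq_iff
    partial_vec_nth[OF C2_on_imp_has_partials(1)[OF assms(1,2)] assms(4)]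
    partial_vec_nth[OF C2_on_imp_has_partials(1)[OF assms(1,3)] assms(4)] inner_eq_signed_inner
  by (auto simp: algebra_simps)

lemma twin_to_minimal_iff:
  fixes f g :: "'n::finite height_map"
  assumes "open S" "C2_on S g" "C2_on S f" "p \<in> S"
  shows "twin_to_minimal g f p \<longleftrightarrow> twin_at (- 1) g f p"
  unfolding twin_to_minimal_def twin_at_def Let_def vec_eq_iff
    partial_vec_nth[OF C2_on_imp_has_partials(1)[OF assms(1,2)] assms(4)]
    partial_vec_nth[OF C2_on_imp_has_partials(1)[OF assms(1,3)] assms(4)] pseudo_inner_eq_signed_inner
  by (auto simp: algebra_simps)

text \<open>Each direction is the reversal in \<open>twin_at_imp\<close>, once for s and once for -
  s. Criticality supplies the positive determinant on the side from which one starts.\<close>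

lemma twin_at_iff:
  fixes \<phi> \<psi> :: "'n::{finite,linorder} height_map"
  assumes S: "open S" and s: "s * s = 1"
    and \<phi>: "positive_area_angle_map S \<phi>" "critical_graph s S \<phi>"
    and \<psi>: "positive_area_angle_map S \<psi>" "critical_graph (- s) S \<psi>" and p: "p \<in> S"
  shows "twin_at s \<phi> \<psi> p \<longleftrightarrow> twin_at (- s) \<psi> \<phi> p"
proof
  have C2: "C2_on S \<phi>" "C2_on S \<psi>" and J: "jacobian_norm \<phi> p < 1" "jacobian_norm \<psi> p < 1"
    using \<phi>(1) \<psi>(1) p by (auto simp: positive_area_angle_map_def)
  note D = \<phi>(2)[unfolded critical_graph_iff[OF S C2(1)], rule_format, OF p]
  note D' = \<psi>(2)[unfolded critical_graph_iff[OF S C2(2)], rule_format, OF p]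
  show "twin_at (- s) \<psi> \<phi> p" if "twin_at s \<phi> \<psi> p"
    using twin_at_imp(9)[OF S C2 p s _ J(1) that] D by blast
  show "twin_at s \<phi> \<psi> p" if "twin_at (- s) \<psi> \<phi> p"
    using twin_at_imp(9)[OF S C2(2,1) p _ _ J(2) that] D' s by simp
qed

lemma exists_twin_same_area_angle:
  fixes \<phi> :: "'n::{finite,linorder} height_map"
  assumes S: "open S" "simply_connected S" and s: "s * s = 1"
    and \<phi>: "positive_area_angle_map S \<phi>" "critical_graph s S \<phi>"
  obtains \<psi> :: "'n height_map" where "positive_area_angle_map S \<psi>" "critical_graph (- s) S \<psi>"
    "\<And>p. p \<in> S \<Longrightarrow> area_angle \<psi> p = area_angle \<phi> p" "\<And>p. p \<in> S \<Longrightarrow> twin_at s \<phi> \<psi> p"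
proof -
  have C2: "C2_on S \<phi>" and J: "\<And>p. p \<in> S \<Longrightarrow> jacobian_norm \<phi> p < 1"
    using \<phi>(1) by (auto simp: positive_area_angle_map_def)
  obtain \<psi> :: "'n height_map" where \<psi>: "C2_on S \<psi>" "critical_graph (- s) S \<psi>"
    "\<And>p. p \<in> S \<Longrightarrow> twin_at s \<phi> \<psi> p"
    using exists_twin[OF S C2 \<phi>(2) s J] by blast
  have "jacobian_norm \<psi> p = jacobian_norm \<phi> p" if p: "p \<in> S" for p
    using twin_at_imp(8)[OF S(1) C2 \<psi>(1) p s _ J[OF p] \<psi>(3)[OF p]]
      \<phi>(2)[unfolded critical_graph_iff[OF S(1) C2], rule_format, OF p] by blast
  with that[of \<psi>] \<psi> J show thesis
    by (simp add: positive_area_angle_map_def area_angle_def)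
qed

theorem theorem13:
  fixes \<Omega> :: "(real \<times> real) set"
  assumes n_ge_2: "2 \<le> CARD('n::{finite,linorder})"
    and domain: "open \<Omega>" "\<Omega> \<noteq> {}" "connected \<Omega>"
    and simply: "simply_connected \<Omega>"
  shows
    "(\<forall>f :: 'n height_map.
        positive_area_angle_map \<Omega> f \<and> minimal_graph \<Omega> f \<longrightarrow>
        (\<exists>g :: 'n height_map.
           positive_area_angle_map \<Omega> g \<and> (\<forall>p\<in>\<Omega>. area_angle g p = area_angle f p) \<and>
           maximal_graph \<Omega> g \<and> (\<forall>p\<in>\<Omega>. twin_to_maximal f g p)))
     \<and>
     (\<forall>g :: 'n height_map.
        positive_area_angle_map \<Omega> g \<and> maximal_graph \<Omega> g \<longrightarrow>
        (\<exists>f :: 'n height_map.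
           positive_area_angle_map \<Omega> f \<and> (\<forall>p\<in>\<Omega>. area_angle f p = area_angle g p) \<and>
           minimal_graph \<Omega> f \<and> (\<forall>p\<in>\<Omega>. twin_to_minimal g f p)))
     \<and>
     (\<forall>(f :: 'n height_map) (g :: 'n height_map).
        positive_area_angle_map \<Omega> f \<and> minimal_graph \<Omega> f \<and>
        positive_area_angle_map \<Omega> g \<and> maximal_graph \<Omega> g \<longrightarrow>
        (\<forall>p\<in>\<Omega>. twin_to_maximal f g p \<longleftrightarrow> twin_to_minimal g f p))
     \<and>
     (\<forall>(f :: 'n height_map) (g :: 'n height_map).
        positive_area_angle_map \<Omega> f \<and> minimal_graph \<Omega> f \<and>
        positive_area_angle_map \<Omega> g \<and> maximal_graph \<Omega> g \<and>
        (\<forall>p\<in>\<Omega>. twin_to_maximal f g p) \<longrightarrow>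
        (\<forall>p\<in>\<Omega>.
           area_angle f p \<in> {0<..pi/2} \<and> area_angle g p = area_angle f p \<and>
           (\<forall>i j. jacobian_det f i j p = jacobian_det g i j p) \<and>
           max_\<omega> g p * min_\<omega> f p = (sin (area_angle f p))\<^sup>2 \<and> (sin (area_angle f p))\<^sup>2 > 0 \<and>
           (\<forall>v. induced_metric inner (graph_map f) p v =
                min_\<omega> f p / max_\<omega> g p * induced_metric pseudo_inner (graph_map g) p v)))
     \<and>
     (\<forall>(f :: 'n height_map) (g :: 'n height_map) (h :: 'n height_map).
        positive_area_angle_map \<Omega> f \<and> minimal_graph \<Omega> f \<and>
        positive_area_angle_map \<Omega> g \<and> maximal_graph \<Omega> g \<and> (\<forall>p\<in>\<Omega>. twin_to_maximal f g p) \<and>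
        positive_area_angle_map \<Omega> h \<and> minimal_graph \<Omega> h \<and> (\<forall>p\<in>\<Omega>. twin_to_minimal g h p) \<longrightarrow>
        (\<exists>c :: (real, 'n) vec. \<forall>p\<in>\<Omega>. graph_map h p = graph_map f p + (0, 0, c)))"
proof (intro conjI allI impI)
  note crit = minimal_graph_eq_critical_graph maximal_graph_eq_critical_graph
  have C2: "C2_on \<Omega> \<phi>" if "positive_area_angle_map \<Omega> \<phi>" for \<phi> :: "'n height_map"
    using that by (simp add: positive_area_angle_map_def)
  note to_max = twin_to_maximal_iff[OF domain(1) C2 C2] and to_min = twin_to_minimal_iff[OF domain(1) C2 C2]
  {
    fix f :: "'n height_map"
    assume f: "positive_area_angle_map \<Omega> f \<and> minimal_graph \<Omega> f"
    then obtain g :: "'n height_map" where "positive_area_angle_map \<Omega> g" "critical_graph (- 1) \<Omega> g"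
      "\<And>p. p \<in> \<Omega> \<Longrightarrow> area_angle g p = area_angle f p" "\<And>p. p \<in> \<Omega> \<Longrightarrow> twin_at 1 f g p"
      using exists_twin_same_area_angle[OF domain(1) simply, of 1 f] by (auto simp: crit)
    then show "\<exists>g :: 'n height_map.
           positive_area_angle_map \<Omega> g \<and> (\<forall>p\<in>\<Omega>. area_angle g p = area_angle f p) \<and>
           maximal_graph \<Omega> g \<and> (\<forall>p\<in>\<Omega>. twin_to_maximal f g p)"
      using f by (intro exI[of _ g]) (simp add: crit to_max)
  next
    fix g :: "'n height_map"
    assume g: "positive_area_angle_map \<Omega> g \<and> maximal_graph \<Omega> g"
    then obtain f :: "'n height_map" where "positive_area_angle_map \<Omega> f" "critical_graph 1 \<Omega> f"
      "\<And>p. p \<in> \<Omega> \<Longrightarrow> area_angle f p = area_angle g p" "\<And>p. p \<in> \<Omega> \<Longrightarrow> twin_at (- 1) g f p"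
      using exists_twin_same_area_angle[OF domain(1) simply, of "- 1" g] by (auto simp: crit)
    then show "\<exists>f :: 'n height_map.
           positive_area_angle_map \<Omega> f \<and> (\<forall>p\<in>\<Omega>. area_angle f p = area_angle g p) \<and>
           minimal_graph \<Omega> f \<and> (\<forall>p\<in>\<Omega>. twin_to_minimal g f p)"
      using g by (intro exI[of _ f]) (simp add: crit to_min)
  }
  show equiv: "\<forall>p\<in>\<Omega>. twin_to_maximal f g p \<longleftrightarrow> twin_to_minimal g f p"
    if "positive_area_angle_map \<Omega> f \<and> minimal_graph \<Omega> f \<and>
        positive_area_angle_map \<Omega> g \<and> maximal_graph \<Omega> g" for f g :: "'n height_map"
    using that twin_at_iff[OF domain(1), of 1 f g] by (simp add: crit to_max to_min)
  {
    fix f g :: "'n height_map"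
    assume fg: "positive_area_angle_map \<Omega> f \<and> minimal_graph \<Omega> f \<and>
        positive_area_angle_map \<Omega> g \<and> maximal_graph \<Omega> g \<and> (\<forall>p\<in>\<Omega>. twin_to_maximal f g p)"
    show "\<forall>p\<in>\<Omega>.
           area_angle f p \<in> {0<..pi/2} \<and> area_angle g p = area_angle f p \<and>
           (\<forall>i j. jacobian_det f i j p = jacobian_det g i j p) \<and>
           max_\<omega> g p * min_\<omega> f p = (sin (area_angle f p))\<^sup>2 \<and> (sin (area_angle f p))\<^sup>2 > 0 \<and>
           (\<forall>v. induced_metric inner (graph_map f) p v =
                min_\<omega> f p / max_\<omega> g p * induced_metric pseudo_inner (graph_map g) p v)"
    proof
      fix p assume p: "p \<in> \<Omega>"
      have J: "jacobian_norm f p < 1" and C2f: "C2_on \<Omega> f" and C2g: "C2_on \<Omega> g"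
        and D: "0 < min_E f p * min_G f p - (min_F f p)\<^sup>2" and tw: "twin_at 1 f g p"
        using fg p critical_graph_iff[OF domain(1) C2, of f 1]
        by (auto simp: positive_area_angle_map_def crit to_max inner_eq_signed_inner)
      note t = twin_at_imp[OF domain(1) C2f C2g p _ D[unfolded inner_eq_signed_inner] J tw, simplified,
          folded inner_eq_signed_inner pseudo_inner_eq_signed_inner]
      have J0: "0 \<le> jacobian_norm f p"
        by (auto simp: jacobian_norm_def intro!: sum_nonneg)
      \<comment> \<open>Angle duality: the product of the area elements is 1 - ||J||^2, and ||J|| is
        the cosine of the area-angle.\<close>
      have "sin (area_angle f p) = sqrt (1 - (jacobian_norm f p)\<^sup>2)"
        unfolding area_angle_def using J J0 by (intro sin_arccos) auto
      then have sin: "(sin (area_angle f p))\<^sup>2 = max_\<omega> g p * min_\<omega> f p"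
        using t(3) mult_pos_pos[OF t(2,1)] by simp
      \<comment> \<open>Strictness of ||J|| < 1 gives a positive angle, and ||J|| >= 0 gives the
        upper bound.\<close>
      have "0 < area_angle f p" "area_angle f p \<le> pi / 2"
        unfolding area_angle_def using arccos_less_arccos[of "jacobian_norm f p" 1] arccos_le_pi2 J J0 by auto
      moreover have "area_angle g p = area_angle f p"
        by (simp add: area_angle_def t(8))
      moreover have "induced_metric inner (graph_map f) p v =
                min_\<omega> f p / max_\<omega> g p * induced_metric pseudo_inner (graph_map g) p v" for v
        using t(1,2) unfolding induced_metric_def t(4-6) by (simp add: field_simps)
      ultimately show "area_angle f p \<in> {0<..pi/2} \<and> area_angle g p = area_angle f p \<and>
           (\<forall>i j. jacobian_det f i j p = jacobian_det g i j p) \<and>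
           max_\<omega> g p * min_\<omega> f p = (sin (area_angle f p))\<^sup>2 \<and> (sin (area_angle f p))\<^sup>2 > 0 \<and>
           (\<forall>v. induced_metric inner (graph_map f) p v =
                min_\<omega> f p / max_\<omega> g p * induced_metric pseudo_inner (graph_map g) p v)"
        using t(1,2,7) by (simp add: sin)
    qed
  next
    fix f g h :: "'n height_map"
    assume fgh: "positive_area_angle_map \<Omega> f \<and> minimal_graph \<Omega> f \<and>
        positive_area_angle_map \<Omega> g \<and> maximal_graph \<Omega> g \<and> (\<forall>p\<in>\<Omega>. twin_to_maximal f g p) \<and>
        positive_area_angle_map \<Omega> h \<and> minimal_graph \<Omega> h \<and> (\<forall>p\<in>\<Omega>. twin_to_minimal g h p)"
    \<comment> \<open>Reversing the first relation makes f, like h, a twin of g. The gradients of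
      both are then the same expression in g, so h - f has derivative 0 and is constant on the
      connected domain.\<close>
    have "twin_at (- 1) g f p" "twin_at (- 1) g h p" if "p \<in> \<Omega>" for p
      using that fgh equiv[of f g] by (auto simp: to_min)
    then have eq: "partial_x h p = partial_x f p" "partial_y h p = partial_y f p" if "p \<in> \<Omega>" for p
      using that unfolding twin_at_def Let_def by metis+
    note hf = has_partials_diff[OF C2_on_imp_has_partials(1)[OF domain(1) C2[of h]] C2_on_imp_has_partials(1)[OF domain(1) C2[of f]]]
    have "((\<lambda>p. h p - f p) has_derivative (\<lambda>_. 0)) (at p)" if "p \<in> \<Omega>" for p
      using has_partialsD(1)[OF hf that] fgh by (simp add: eq[OF that])
    then obtain c where "\<And>p. p \<in> \<Omega> \<Longrightarrow> h p - f p = c"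
      using has_derivative_zero_unique_connected[OF domain(1,3), of "\<lambda>p. h p - f p"] domain(2)
      by (metis (no_types, lifting) ex_in_conv)
    then have "h p = f p + c" if "p \<in> \<Omega>" for p
      using that by (metis add.commute diff_add_cancel)
    then show "\<exists>c :: (real, 'n) vec. \<forall>p\<in>\<Omega>. graph_map h p = graph_map f p + (0, 0, c)"
      by (intro exI[of _ c]) (simp add: graph_map_def)
  }
qed

end
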